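(* Let $f,g\in\mathcal F$ be two randomly chosen elements (chosen independently). Then the probability that the group $\langle f,g\rangle$ is discrete is at least $\frac{1}{20}$.
   Context: $\mathbb S$ is the unit circle in $\mathbb C$. $\mathcal F$ is the group of matrices $A=\pm\begin{pmatrix} a & c\\ \bar c & \bar a\end{pmatrix}\in PSL(2,\mathbb C)$ with $a,c\in\mathbb C$, $|a|^2-|c|^2=1$, identified with the group of Möbius transformations $f(z)=\frac{az+c}{\bar c z+\bar a}$ preserving $\mathbb S$ and the unit disk. A random (randomly chosen) element of $\mathcal F$ is obtained by choosing, independently, $a/|a|$ and $c/|c|$ uniformly on $\mathbb S$ with respect to arclength, and $|a|\ge 1$ such that $2\arcsin(1/|a|)$ is uniformly distributed in $[0,\pi]$, with $|c|=\sqrt{|a|^2-1}$. *)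

theory Defs
  imports "HOL-Probability.Probability" "HOL-Algebra.Generated_Groups"
begin

section \<open>The group PSL(2,C) and its topology\<close>

definition SL2C :: "(complex^2^2) monoid" where
  "SL2C = \<lparr>carrier = {A. det A = 1}, mult = (**), one = mat 1\<rparr>"

definition PSL2C :: "(complex^2^2) set monoid" where
  "PSL2C = SL2C Mod {mat 1, - mat 1}"

text \<open>The quotient topology. The elements of \<^term>\<open>PSL2C\<close> are cosets \<open>{A, -A}\<close>, so
  \<open>\<Union>U\<close> is the preimage of \<open>U\<close> under the projection from \<open>SL2C\<close>.\<close>

definition PSL2C_topology :: "(complex^2^2) set topology" where
  "PSL2C_topology = topology (\<lambda>U. U \<subseteq> carrier PSL2C
      \<and> openin (top_of_set (carrier SL2C)) (\<Union>U))"

definition discrete_in_PSL2C :: "(complex^2^2) set set \<Rightarrow> bool" where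
  "discrete_in_PSL2C G \<longleftrightarrow> subtopology PSL2C_topology G = discrete_topology G"

section \<open>The group of Moebius transformations preserving the unit disk\<close>

definition disk_matrix :: "complex \<Rightarrow> complex \<Rightarrow> complex^2^2" where
  "disk_matrix a c = vector [vector [a, c], vector [cnj c, cnj a]]"

definition disk_elem :: "complex \<Rightarrow> complex \<Rightarrow> (complex^2^2) set" where
  "disk_elem a c = {mat 1, - mat 1} #>\<^bsub>SL2C\<^esub> disk_matrix a c"

definition disk_group :: "(complex^2^2) set set" where
  "disk_group = {disk_elem a c | a c. (cmod a)\<^sup>2 - (cmod c)\<^sup>2 = 1}"

section \<open>Random elements\<close>

definition uniform_circle :: "complex measure" where
  "uniform_circle = distr (uniform_measure lborel {0..2 * pi}) borel cis"

text \<open>The equation of measures says at once that the three random variables have the prescribed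
  laws and that they are independent. The unit vector \<open>c/\<bar>c\<bar>\<close> is \<open>0\<close> where \<open>c = 0\<close>; that this
  occurs with probability zero is a consequence of the prescribed law.\<close>

definition random_entries ::
    "'w measure \<Rightarrow> ('w \<Rightarrow> complex) \<Rightarrow> ('w \<Rightarrow> complex) \<Rightarrow> bool" where
  "random_entries M a c \<longleftrightarrow>
     a \<in> borel_measurable M \<and> c \<in> borel_measurable M \<and>
     (\<forall>\<omega>\<in>space M. (cmod (a \<omega>))\<^sup>2 - (cmod (c \<omega>))\<^sup>2 = 1) \<and>
     distr M borel (\<lambda>\<omega>. (a \<omega> / cmod (a \<omega>), c \<omega> / cmod (c \<omega>), 2 * arcsin (1 / cmod (a \<omega>))))
       = uniform_circle \<Otimes>\<^sub>M uniform_circle \<Otimes>\<^sub>M uniform_measure lborel {0..pi}"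

text \<open>Two random elements are chosen independently when their pairs of entries are independent.\<close>

definition independent_random_elements ::
    "'w measure \<Rightarrow> ('w \<Rightarrow> (complex^2^2) set) \<Rightarrow> ('w \<Rightarrow> (complex^2^2) set) \<Rightarrow> bool" where
  "independent_random_elements M f g \<longleftrightarrow>
     (\<exists>a c b d. random_entries M a c \<and> random_entries M b d \<and>
        prob_space.indep_var M borel (\<lambda>\<omega>. (a \<omega>, c \<omega>)) borel (\<lambda>\<omega>. (b \<omega>, d \<omega>)) \<and>
        (\<forall>\<omega>\<in>space M. f \<omega> = disk_elem (a \<omega>) (c \<omega>) \<and> g \<omega> = disk_elem (b \<omega>) (d \<omega>)))"

section \<open>Basic facts\<close>

lemma group_SL2C: "group SL2C"
proof (rule groupI)
  fix x assume x: "x \<in> carrier SL2C"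
  then have "invertible x" by (simp add: SL2C_def invertible_det_nz)
  then obtain y where y: "x ** y = mat 1" "y ** x = mat 1" unfolding invertible_def by blast
  have "det y * det x = 1" using arg_cong[OF y(2), of det] by (simp add: det_mul)
  then show "\<exists>y\<in>carrier SL2C. y \<otimes>\<^bsub>SL2C\<^esub> x = \<one>\<^bsub>SL2C\<^esub>"
    using x y by (intro bexI[of _ y]) (simp_all add: SL2C_def)
qed (simp_all add: SL2C_def det_mul matrix_mul_assoc)

lemma neg_mult: "(- A) ** B = - (A ** (B::complex^2^2))" "A ** (- B) = - (A ** B)"
  by (simp_all add: vec_eq_iff matrix_matrix_mult_def sum_negf)

lemma det_neg: "det (- A) = det (A::complex^2^2)"
  by (simp add: det_2)

lemma coset_eq: "{mat 1, - mat 1} #>\<^bsub>SL2C\<^esub> A = {A, - A}"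
  unfolding r_coset_def by (simp add: SL2C_def neg_mult insert_commute)

lemma normal_SL2C: "{mat 1, - mat 1} \<lhd> SL2C"
proof -
  interpret group SL2C by (rule group_SL2C)
  have "subgroup {mat 1, - mat 1} SL2C"
  proof (rule subgroupI)
    fix x assume "x \<in> {mat 1, - mat 1 :: complex^2^2}"
    then have "inv\<^bsub>SL2C\<^esub> x = x"
      by (intro inv_equality) (auto simp: SL2C_def neg_mult det_neg)
    then show "inv\<^bsub>SL2C\<^esub> x \<in> {mat 1, - mat 1}" using \<open>x \<in> _\<close> by simp
  qed (auto simp: SL2C_def neg_mult det_neg)
  then show ?thesis
    unfolding normal_def normal_axioms_def
    by (intro conjI ballI group_SL2C)
      (simp_all add: coset_eq, simp add: l_coset_def SL2C_def neg_mult insert_commute)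
qed

lemma group_PSL2C: "group PSL2C"
  unfolding PSL2C_def by (rule normal.factorgroup_is_group[OF normal_SL2C])

lemma carrier_PSL2C: "carrier PSL2C = {{A, - A} | A. det A = 1}"
  by (auto simp: PSL2C_def FactGroup_def RCOSETS_def coset_eq) (auto simp: SL2C_def)

lemma istopology_PSL2C:
  "istopology (\<lambda>U. U \<subseteq> carrier PSL2C \<and> openin (top_of_set (carrier SL2C)) (\<Union>U))"
proof -
  have coset: "X = {x, - x}" if "X \<in> carrier PSL2C" "x \<in> X" for X x
    using that unfolding carrier_PSL2C by force
  have *: "\<Union>(S \<inter> T) = \<Union>S \<inter> \<Union>T"
    if "S \<subseteq> carrier PSL2C" "T \<subseteq> carrier PSL2C" for S T
  proof (intro equalityI subsetI)
    fix x assume "x \<in> \<Union>S \<inter> \<Union>T"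
    then obtain X Y where X: "X \<in> S" "x \<in> X" and Y: "Y \<in> T" "x \<in> Y" by blast
    then have "X = Y" using coset[of X x] coset[of Y x] that by (metis subsetD)
    then show "x \<in> \<Union>(S \<inter> T)" using X Y by blast
  qed blast
  have **: "\<Union>(\<Union>K) = \<Union>(Union ` K)" for K :: "(complex^2^2) set set set" by blast
  show ?thesis
    unfolding istopology_def
  proof (intro conjI allI impI)
    fix K :: "(complex^2^2) set set set"
    assume K: "\<forall>U\<in>K. U \<subseteq> carrier PSL2C \<and> openin (top_of_set (carrier SL2C)) (\<Union>U)"
    then show "\<Union>K \<subseteq> carrier PSL2C" by blast
    show "openin (top_of_set (carrier SL2C)) (\<Union>(\<Union>K))"
      unfolding ** using K by (intro openin_Union) blast
  qed (simp_all add: * openin_Int le_infI1)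
qed

lemma openin_PSL2C:
  "openin PSL2C_topology U \<longleftrightarrow>
     U \<subseteq> carrier PSL2C \<and> openin (top_of_set (carrier SL2C)) (\<Union>U)"
  unfolding PSL2C_topology_def topology_inverse'[OF istopology_PSL2C] ..

lemma disk_matrix_nth [simp]:
  "disk_matrix a c $ 1 $ 1 = a" "disk_matrix a c $ 1 $ 2 = c"
  "disk_matrix a c $ 2 $ 1 = cnj c" "disk_matrix a c $ 2 $ 2 = cnj a"
  by (simp_all add: disk_matrix_def)

lemma det_disk_matrix: "det (disk_matrix a c) = of_real ((cmod a)\<^sup>2 - (cmod c)\<^sup>2)"
  by (simp add: det_2 complex_norm_square del: of_real_power)

lemma disk_elem_eq: "disk_elem a c = {disk_matrix a c, - disk_matrix a c}"
  by (simp add: disk_elem_def coset_eq)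

lemma subgroup_disk_group: "subgroup disk_group PSL2C"
proof -
  interpret N: normal "{mat 1, - mat 1}" SL2C by (rule normal_SL2C)
  interpret P: group PSL2C by (rule group_PSL2C)
  have car: "disk_matrix a c \<in> carrier SL2C" if "(cmod a)\<^sup>2 - (cmod c)\<^sup>2 = 1" for a c
    using that by (simp add: SL2C_def det_disk_matrix)
  have mat: "disk_matrix a c ** disk_matrix b d = disk_matrix (a * b + c * cnj d) (a * d + c * cnj b)"
    for a b c d
    by (simp add: vec_eq_iff forall_2 matrix_matrix_mult_def sum_2 algebra_simps)
  have mul: "disk_elem a c \<otimes>\<^bsub>PSL2C\<^esub> disk_elem b d
      = disk_elem (a * b + c * cnj d) (a * d + c * cnj b)"
    if "(cmod a)\<^sup>2 - (cmod c)\<^sup>2 = 1" "(cmod b)\<^sup>2 - (cmod d)\<^sup>2 = 1" for a b c d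
    using mat car[OF that(1)] car[OF that(2)] N.rcos_sum
    by (simp add: PSL2C_def FactGroup_def disk_elem_def) (simp add: SL2C_def)
  have cl: "(cmod (a * b + c * cnj d))\<^sup>2 - (cmod (a * d + c * cnj b))\<^sup>2 = 1"
    if "(cmod a)\<^sup>2 - (cmod c)\<^sup>2 = 1" "(cmod b)\<^sup>2 - (cmod d)\<^sup>2 = 1" for a b c d
  proof -
    have "complex_of_real ((cmod (a * b + c * cnj d))\<^sup>2 - (cmod (a * d + c * cnj b))\<^sup>2) = of_real 1"
      unfolding det_disk_matrix[symmetric] mat[symmetric] det_mul
      unfolding det_disk_matrix that by simp
    then show ?thesis by (simp only: of_real_eq_iff)
  qed
  have one: "\<one>\<^bsub>PSL2C\<^esub> = disk_elem 1 0"
    by (auto simp: PSL2C_def FactGroup_def disk_elem_eq vec_eq_iff forall_2 mat_def)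
  have inv: "inv\<^bsub>PSL2C\<^esub> (disk_elem a c) = disk_elem (cnj a) (- c)"
    if h: "(cmod a)\<^sup>2 - (cmod c)\<^sup>2 = 1" for a c
  proof (rule P.inv_equality)
    have h': "(cmod (cnj a))\<^sup>2 - (cmod (- c))\<^sup>2 = 1" using h by simp
    have "cnj a * a - c * cnj c = 1"
      using arg_cong[OF h, of complex_of_real]
      by (simp add: complex_norm_square mult.commute del: of_real_power)
    then show "disk_elem (cnj a) (- c) \<otimes>\<^bsub>PSL2C\<^esub> disk_elem a c = \<one>\<^bsub>PSL2C\<^esub>"
      by (simp add: mul[OF h' h] one mult.commute)
  qed (use h in \<open>auto simp: carrier_PSL2C disk_elem_eq det_disk_matrix\<close>)
  show ?thesis
  proof (rule P.subgroupI)
    show "disk_group \<subseteq> carrier PSL2C"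
      by (auto simp: disk_group_def carrier_PSL2C disk_elem_eq det_disk_matrix)
    show "disk_group \<noteq> {}"
    proof -
      have "disk_elem 1 0 \<in> disk_group"
        unfolding disk_group_def by (intro CollectI exI[of _ 1] exI[of _ 0]) simp
      then show ?thesis by blast
    qed
  next
    fix x assume "x \<in> disk_group"
    then obtain a c where h: "x = disk_elem a c" "(cmod a)\<^sup>2 - (cmod c)\<^sup>2 = 1"
      unfolding disk_group_def by blast
    show "inv\<^bsub>PSL2C\<^esub> x \<in> disk_group"
      unfolding disk_group_def h(1) inv[OF h(2)]
      using h(2) by (intro CollectI exI[of _ "cnj a"] exI[of _ "- c"]) simp
  next
    fix x y assume "x \<in> disk_group" "y \<in> disk_group"
    then obtain a c b d where h: "x = disk_elem a c" "(cmod a)\<^sup>2 - (cmod c)\<^sup>2 = 1"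
        "y = disk_elem b d" "(cmod b)\<^sup>2 - (cmod d)\<^sup>2 = 1"
      unfolding disk_group_def by blast
    show "x \<otimes>\<^bsub>PSL2C\<^esub> y \<in> disk_group"
      unfolding disk_group_def h(1,3) mul[OF h(2,4)] using cl[OF h(2,4)] by blast
  qed
qed

lemma independent_random_elements_in_disk_group:
  assumes "independent_random_elements M f g" "\<omega> \<in> space M"
  shows "f \<omega> \<in> disk_group" "g \<omega> \<in> disk_group"
  using assms unfolding independent_random_elements_def random_entries_def disk_group_def
  by blast+

lemma prob_uniform_angle: "prob_space (uniform_measure lborel {0..b::real})" if "b > 0" for b
  using that by (intro prob_space_uniform_measure) auto

lemma cis_measurable [measurable]: "cis \<in> borel_measurable borel"
  by (intro borel_measurable_continuous_onI continuous_intros)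

lemma prob_uniform_circle: "prob_space uniform_circle"
  unfolding uniform_circle_def
  by (intro prob_space.prob_space_distr prob_uniform_angle) simp_all

lemma sets_uniform_circle [measurable_cong, simp]: "sets uniform_circle = sets borel"
  by (simp add: uniform_circle_def)

lemma AE_uniform_circle: "AE z in uniform_circle. cmod z = 1"
  unfolding uniform_circle_def
  by (subst AE_distr_iff) simp_all

lemma random_elements_exist:
  "\<exists>(M :: ((complex \<times> complex \<times> real) \<times> (complex \<times> complex \<times> real)) measure) f g.
     prob_space M \<and> independent_random_elements M f g"
proof -
  let ?T = "uniform_measure lborel {0..pi}"
  define P where "P = uniform_circle \<Otimes>\<^sub>M uniform_circle \<Otimes>\<^sub>M ?T"
  have T: "prob_space ?T" by (rule prob_uniform_angle) simp
  have CT: "prob_space (uniform_circle \<Otimes>\<^sub>M ?T)"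
    by (rule prob_space_pair[OF prob_uniform_circle T])
  have P: "prob_space P" unfolding P_def by (rule prob_space_pair[OF prob_uniform_circle CT])
  have Q: "prob_space (P \<Otimes>\<^sub>M P)" by (rule prob_space_pair[OF P P])
  interpret C: prob_space uniform_circle by (rule prob_uniform_circle)
  interpret T: prob_space ?T by (rule T)
  interpret CT: pair_prob_space uniform_circle ?T ..
  interpret CCT: pair_sigma_finite uniform_circle "uniform_circle \<Otimes>\<^sub>M ?T"
    by (intro pair_sigma_finite.intro prob_space_imp_sigma_finite prob_uniform_circle CT)
  interpret PP: pair_sigma_finite P P
    by (intro pair_sigma_finite.intro prob_space_imp_sigma_finite P)
  have [measurable_cong]: "sets P = sets (borel \<Otimes>\<^sub>M borel \<Otimes>\<^sub>M borel)"
    unfolding P_def by (intro sets_pair_measure_cong) simp_all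
  then have sets_P: "sets P = sets borel" by (simp only: borel_prod)
  define good where "good = (\<lambda>(u :: complex, v :: complex, t :: real).
    cmod u = 1 \<and> cmod v = 1 \<and> 0 < t \<and> t < pi)"
  define A :: "complex \<times> complex \<times> real \<Rightarrow> complex"
    where "A = (\<lambda>x. if good x then fst x * of_real (1 / sin (snd (snd x) / 2)) else 1)"
  define B :: "complex \<times> complex \<times> real \<Rightarrow> complex"
    where "B = (\<lambda>x. if good x
      then fst (snd x) * of_real (sqrt ((1 / sin (snd (snd x) / 2))\<^sup>2 - 1)) else 0)"
  define J :: "complex \<times> complex \<times> real \<Rightarrow> complex \<times> complex \<times> real"
    where "J = (\<lambda>x. (A x / cmod (A x), B x / cmod (B x), 2 * arcsin (1 / cmod (A x))))"
  have [measurable]: "Measurable.pred (borel \<Otimes>\<^sub>M borel \<Otimes>\<^sub>M borel) good"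
    unfolding good_def by measurable
  have [measurable]: "A \<in> borel_measurable P" "B \<in> borel_measurable P"
    unfolding A_def B_def by measurable
  have rel: "(cmod (A x))\<^sup>2 - (cmod (B x))\<^sup>2 = 1"
    and JJ: "good x \<Longrightarrow> J x = x" for x
  proof -
    obtain u v t where x: "x = (u, v, t)" by (cases x)
    have *: "(cmod (A x))\<^sup>2 - (cmod (B x))\<^sup>2 = 1 \<and> J x = x" if g: "good x"
    proof -
      have g: "cmod u = 1" "cmod v = 1" "0 < t" "t < pi" using g by (simp_all add: x good_def)
      define s where "s = sin (t / 2)"
      have s: "0 < s" using g unfolding s_def by (intro sin_gt_zero) auto
      have "sin (t / 2) < sin (pi / 2)" using g by (intro sin_monotone_2pi) auto
      then have s1: "s < 1" by (simp add: s_def)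
      have r: "(1 / s)\<^sup>2 > 1" using s s1 by (simp add: power_divide power_less_one_iff)
      have A: "A x = u * of_real (1 / s)" and B: "B x = v * of_real (sqrt ((1 / s)\<^sup>2 - 1))"
        using \<open>good x\<close> by (simp_all add: A_def B_def x s_def)
      have nA: "cmod (A x) = 1 / s" and nB: "cmod (B x) = sqrt ((1 / s)\<^sup>2 - 1)"
        unfolding A B using g s r by (simp_all add: norm_mult norm_divide del: of_real_divide)
      have "arcsin s = t / 2" unfolding s_def using g by (intro arcsin_sin) auto
      moreover have "A x / cmod (A x) = u" unfolding nA using s by (simp add: A)
      moreover have "B x / cmod (B x) = v"
      proof -
        have "sqrt ((1 / s)\<^sup>2 - 1) \<noteq> 0" using r by simp
        then show ?thesis unfolding nB unfolding B
          by (intro nonzero_mult_div_cancel_right) (simp only: of_real_eq_0_iff not_False_eq_True)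
      qed
      moreover have "(cmod (A x))\<^sup>2 - (cmod (B x))\<^sup>2 = 1" unfolding nA nB using r by simp
      moreover have "1 / cmod (A x) = s" unfolding nA by simp
      ultimately show ?thesis by (simp add: J_def x)
    qed
    show "(cmod (A x))\<^sup>2 - (cmod (B x))\<^sup>2 = 1"
      using * by (cases "good x") (simp_all add: A_def B_def)
    show "good x \<Longrightarrow> J x = x" using * by blast
  qed
  have "1 / cmod (A x) \<in> {-1..1}" for x
  proof -
    have "1 \<le> (cmod (A x))\<^sup>2" using rel[of x] zero_le_power2[of "cmod (B x)"] by linarith
    then have "1 \<le> cmod (A x)" by (smt (verit) norm_ge_zero power_le_one power2_le_imp_le one_power2)
    then show ?thesis by (auto simp: divide_simps intro: order_trans[of _ 0])
  qed
  then have "(\<lambda>x. 1 / cmod (A x)) \<in> P \<rightarrow>\<^sub>M restrict_space borel {-1..1}"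
    by (intro measurable_restrict_space2) auto
  moreover have "arcsin \<in> borel_measurable (restrict_space borel {-1..1})"
    by (intro borel_measurable_continuous_on_restrict continuous_on_arcsin') 
  ultimately have [measurable]: "(\<lambda>x. arcsin (1 / cmod (A x))) \<in> borel_measurable P"
    by (rule measurable_compose)
  have J [measurable]: "J \<in> P \<rightarrow>\<^sub>M borel"
    unfolding J_def borel_prod[symmetric] by measurable
  have AET: "AE t in ?T. 0 < t \<and> t < pi"
  proof (rule AE_uniform_measureI)
    have "AE t in lborel. t \<noteq> 0 \<and> t \<noteq> pi"
      using AE_lborel_singleton[of 0] AE_lborel_singleton[of pi] by eventually_elim simp
    then show "AE t in lborel. t \<in> {0..pi} \<longrightarrow> 0 < t \<and> t < pi"
      by eventually_elim auto
  qed simp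
  have "AE y in uniform_circle \<Otimes>\<^sub>M ?T. cmod (fst y) = 1 \<and> 0 < snd y \<and> snd y < pi"
  proof (rule CT.AE_pair_measure)
    show "AE x in uniform_circle. AE y in ?T.
        cmod (fst (x, y)) = 1 \<and> 0 < snd (x, y) \<and> snd (x, y) < pi"
      using AE_uniform_circle
    proof (rule eventually_mono)
      fix x :: complex assume "cmod x = 1"
      with AET show "AE y in ?T. cmod (fst (x, y)) = 1 \<and> 0 < snd (x, y) \<and> snd (x, y) < pi"
        by (auto elim: eventually_mono)
    qed
  qed measurable
  note AE_CT = this
  have "AE x in P. good x"
    unfolding P_def
  proof (rule CCT.AE_pair_measure)
    show "AE x in uniform_circle. AE y in uniform_circle \<Otimes>\<^sub>M ?T. good (x, y)"
      using AE_uniform_circle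
    proof (rule eventually_mono)
      fix x :: complex assume "cmod x = 1"
      then show "AE y in uniform_circle \<Otimes>\<^sub>M ?T. good (x, y)"
        by (intro eventually_mono[OF AE_CT]) (auto simp: good_def)
    qed
  qed measurable
  then have "AE x in P. J x = x" by eventually_elim (rule JJ)
  then have "distr P borel J = distr P borel (\<lambda>x. x)"
    by (intro distr_cong_AE J measurable_ident_sets sets_P) simp_all
  also have "\<dots> = P" by (rule distr_id2) (simp add: sets_P)
  finally have law: "distr P borel J = P" .
  have fst: "distr (P \<Otimes>\<^sub>M P) N (\<lambda>x. h (fst x)) = distr P N h" if [measurable]: "h \<in> P \<rightarrow>\<^sub>M N"
    for h and N :: "'z measure"
    using prob_space.distr_pair_fst[OF P, of P] distr_distr[of h P N fst "P \<Otimes>\<^sub>M P"] by (simp add: comp_def)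
  have snd: "distr (P \<Otimes>\<^sub>M P) N (\<lambda>x. h (snd x)) = distr P N h" if [measurable]: "h \<in> P \<rightarrow>\<^sub>M N"
    for h and N :: "'z measure"
  proof -
    have "distr (P \<Otimes>\<^sub>M P) P snd = P"
      using prob_space.distr_pair_fst[OF P, of P] PP.distr_pair_swap
        distr_distr[of fst "P \<Otimes>\<^sub>M P" P "\<lambda>(x, y). (y, x)" "P \<Otimes>\<^sub>M P"]
      by (simp add: comp_def case_prod_beta)
    then show ?thesis using distr_distr[of h P N snd "P \<Otimes>\<^sub>M P"] by (simp add: comp_def)
  qed
  have AB [measurable]: "(\<lambda>x. (A x, B x)) \<in> P \<rightarrow>\<^sub>M borel"
    unfolding borel_prod[symmetric] by measurable
  have "prob_space.indep_var (P \<Otimes>\<^sub>M P) borel (\<lambda>x. (A (fst x), B (fst x))) borel (\<lambda>x. (A (snd x), B (snd x)))"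
    unfolding prob_space.indep_var_distribution_eq[OF Q] fst[OF AB] snd[OF AB]
  proof (intro conjI)
    show "distr P borel (\<lambda>x. (A x, B x)) \<Otimes>\<^sub>M distr P borel (\<lambda>x. (A x, B x))
      = distr (P \<Otimes>\<^sub>M P) (borel \<Otimes>\<^sub>M borel) (\<lambda>x. ((A (fst x), B (fst x)), A (snd x), B (snd x)))"
      using pair_measure_distr[OF AB AB] prob_space.prob_space_distr[OF P AB]
      by (simp add: case_prod_unfold prob_space_imp_sigma_finite)
  qed (measurable, measurable)
  moreover have "random_entries (P \<Otimes>\<^sub>M P) (\<lambda>x. A (fst x)) (\<lambda>x. B (fst x))"
    unfolding random_entries_def using rel fst[OF J] law by (simp add: J_def P_def[symmetric])
  moreover have "random_entries (P \<Otimes>\<^sub>M P) (\<lambda>x. A (snd x)) (\<lambda>x. B (snd x))"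
    unfolding random_entries_def using rel snd[OF J] law by (simp add: J_def P_def[symmetric])
  ultimately have "independent_random_elements (P \<Otimes>\<^sub>M P)
      (\<lambda>x. disk_elem (A (fst x)) (B (fst x))) (\<lambda>x. disk_elem (A (snd x)) (B (snd x)))"
    unfolding independent_random_elements_def by blast
  then show ?thesis using Q by blast
qed

end

theory Submission
  imports Defs
begin

text \<open>
  A transformation with entries \<open>(a, c)\<close>, \<open>c \<noteq> 0\<close>, maps the exterior of its isometric disk
  \<open>\<bar>cnj c * z + cnj a\<bar> < 1\<close> into the closed isometric disk of its inverse. The two disks meet the
  unit circle orthogonally, in arcs of length \<open>2 arcsin (1 / \<bar>a\<bar>)\<close>, and the disk of the inverse has its
  centre in the direction of \<open>a * c\<close>. If for two transformations the four isometric disks have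
  disjoint interiors, ping-pong applies: a nonempty reduced word moves the origin, which lies outside
  all the disks, into one of the four closed disks, hence at least a fixed distance away. So no nonempty
  reduced word is close to the identity, and the group is discrete (\<open>discrete_if_disjoint_disks\<close>).

  Disks orthogonal to the unit circle have disjoint interiors when their arcs do, so it remains to
  compute the probability that four arcs have disjoint interiors. Under the prescribed law the
  directions of the four centres are independent and uniform, because
  \<open>(s, t) \<mapsto> (s + t, \<pi> + t - s)\<close> preserves the Haar measure of the torus, and the two arc lengths
  \<open>\<theta>\<close> (for the first two arcs) and \<open>\<phi>\<close> (for the other two) are uniform on \<open>[0, \<pi>]\<close>.
  For given lengths with \<open>\<theta> + \<phi> \<le> \<pi>\<close>, collapsing each arc to a point turns a disjoint configuration
  into four points on a circle of length \<open>D = 2 \<pi> - 2 \<theta> - 2 \<phi>\<close>, and on each cyclic order this is a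
  translation of the centres. Relative to the first arc the configurations have volume at least
  \<open>D ^ 3\<close> (\<open>emeasure_centres_ge\<close>), that is, probability at least \<open>(1 - (\<theta> + \<phi>) / \<pi>) ^ 3\<close>.
  The mean of this quantity over the two lengths is \<open>1 / 20\<close> (\<open>integral_arc_lengths\<close>).

  The probability space is not assumed to be complete, so the event that the group is discrete has to be
  measurable for its measure to say anything. It is, since discreteness is a countable
  condition on the values of the words in the two generators (\<open>discrete_event_measurable\<close>).\<close>

section \<open>Discrete subgroups of PSL(2,C)\<close>

lemma mult_PSL2C:
  assumes "det A = 1" "det B = 1"
  shows "{A, - A} \<otimes>\<^bsub>PSL2C\<^esub> {B, - B} = {A ** B, - (A ** B)}"
proof -
  interpret N: normal "{mat 1, - mat 1}" SL2C by (rule normal_SL2C)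
  have "({mat 1, - mat 1} #>\<^bsub>SL2C\<^esub> A) <#>\<^bsub>SL2C\<^esub> ({mat 1, - mat 1} #>\<^bsub>SL2C\<^esub> B)
      = {mat 1, - mat 1} #>\<^bsub>SL2C\<^esub> (A \<otimes>\<^bsub>SL2C\<^esub> B)"
    using assms by (intro N.rcos_sum) (simp_all add: SL2C_def)
  then show ?thesis by (simp add: PSL2C_def FactGroup_def coset_eq) (simp add: SL2C_def)
qed

lemma one_PSL2C: "\<one>\<^bsub>PSL2C\<^esub> = {mat 1, - mat 1}"
  by (simp add: PSL2C_def FactGroup_def)

lemma topspace_PSL2C: "topspace PSL2C_topology = carrier PSL2C"
proof -
  have "\<Union>(carrier PSL2C) = carrier SL2C"
    by (auto simp: carrier_PSL2C SL2C_def det_neg)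
  then have "openin PSL2C_topology (carrier PSL2C)"
    by (simp add: openin_PSL2C)
  then show ?thesis
    by (intro subset_antisym openin_subset) (use openin_topspace openin_PSL2C in blast)
qed

lemma continuous_matrix_mult_left:
  "continuous_on S (\<lambda>X. A ** (X :: complex^2^2))"
  unfolding matrix_matrix_mult_def
  by (intro continuous_intros)

text \<open>A topological group is discrete as soon as the identity is isolated, since left translation by
  \<open>inv x\<close> is continuous and moves \<open>x\<close> to the identity. Stated on matrices, isolation of the
  identity coset is a metric condition, which the words can be tested against.\<close>

lemma discrete_iff_isolated_identity:
  assumes G: "subgroup G PSL2C"
  shows "discrete_in_PSL2C G \<longleftrightarrow>
    (\<exists>e>0. \<forall>X. {X, - X} \<in> G \<longrightarrow> dist X (mat 1) < e \<longrightarrow> X = mat 1 \<or> X = - mat 1)"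
proof
  interpret P: group PSL2C by (rule group_PSL2C)
  interpret G: subgroup G PSL2C by (rule G)
  assume "discrete_in_PSL2C G"
  then have "openin (subtopology PSL2C_topology G) {\<one>\<^bsub>PSL2C\<^esub>}"
    unfolding discrete_in_PSL2C_def using G.one_closed by simp
  then obtain U where U: "openin PSL2C_topology U" and UG: "{\<one>\<^bsub>PSL2C\<^esub>} = U \<inter> G"
    unfolding openin_subtopology by blast
  have "openin (top_of_set (carrier SL2C)) (\<Union>U)" using U by (simp add: openin_PSL2C)
  moreover have "mat 1 \<in> \<Union>U" using UG by (auto simp: one_PSL2C)
  ultimately obtain e where e: "e > 0"
      "\<And>X. X \<in> carrier SL2C \<Longrightarrow> dist X (mat 1) < e \<Longrightarrow> X \<in> \<Union>U"
    unfolding openin_euclidean_subtopology_iff by blast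
  show "\<exists>e>0. \<forall>X. {X, - X} \<in> G \<longrightarrow> dist X (mat 1) < e \<longrightarrow> X = mat 1 \<or> X = - mat 1"
  proof (intro exI[of _ e] conjI allI impI e(1))
    fix X assume X: "{X, - X} \<in> G" "dist X (mat 1) < e"
    have "det X = 1"
    proof -
      have "{X, - X} \<in> carrier PSL2C" using X(1) G.subset by blast
      then show ?thesis by (auto simp: carrier_PSL2C doubleton_eq_iff det_neg)
    qed
    then obtain Y where Y: "Y \<in> U" "X \<in> Y" using e(2)[OF _ X(2)] by (auto simp: SL2C_def)
    then have "Y \<in> carrier PSL2C" using U by (auto simp: openin_PSL2C)
    then obtain Z where "Y = {Z, - Z}" by (auto simp: carrier_PSL2C)
    then have "Y = {X, - X}" using Y(2) by auto
    then have "{X, - X} \<in> U \<inter> G" using Y(1) X(1) by simp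
    then have "{X, - X} = {mat 1, - mat 1}" by (simp only: UG[symmetric] one_PSL2C singleton_iff)
    then show "X = mat 1 \<or> X = - mat 1" by blast
  qed
next
  interpret P: group PSL2C by (rule group_PSL2C)
  interpret G: subgroup G PSL2C by (rule G)
  assume "\<exists>e>0. \<forall>X. {X, - X} \<in> G \<longrightarrow> dist X (mat 1) < e \<longrightarrow> X = mat 1 \<or> X = - mat 1"
  then obtain e where e: "e > 0"
    "\<And>X. {X, - X} \<in> G \<Longrightarrow> dist X (mat 1) < e \<Longrightarrow> X = mat 1 \<or> X = - mat 1" by blast
  have "openin (subtopology PSL2C_topology G) {x}" if x: "x \<in> G" for x
  proof -
    have "inv\<^bsub>PSL2C\<^esub> x \<in> carrier PSL2C" using x G.mem_carrier by blast
    then obtain A where A: "inv\<^bsub>PSL2C\<^esub> x = {A, - A}" "det A = 1" by (auto simp: carrier_PSL2C)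
    \<comment> \<open>The neighbourhood of the identity, translated to \<open>x\<close>; the two alternatives make it a union of cosets.\<close>
    define V where "V = {X \<in> carrier SL2C. dist (A ** X) (mat 1) < e \<or> dist (A ** (- X)) (mat 1) < e}"
    define U where "U = {y \<in> carrier PSL2C. y \<subseteq> V}"
    have V_neg: "- X \<in> V \<longleftrightarrow> X \<in> V" for X
      by (auto simp: V_def SL2C_def det_neg)
    have "\<Union>U = V"
    proof
      show "V \<subseteq> \<Union>U"
      proof
        fix X assume X: "X \<in> V"
        then have "{X, - X} \<in> U"
          using V_neg[of X] by (auto simp: U_def carrier_PSL2C V_def SL2C_def)
        then show "X \<in> \<Union>U" by blast
      qed
    qed (auto simp: U_def)
    moreover have "openin (top_of_set (carrier SL2C)) V"
    proof -
      have "open {X. dist (A ** X) (mat 1) < e}" "open {X. dist (A ** (- X)) (mat 1) < e}"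
        unfolding neg_mult
        by (intro open_Collect_less continuous_intros continuous_matrix_mult_left)+
      then have "open ({X. dist (A ** X) (mat 1) < e} \<union> {X. dist (A ** (- X)) (mat 1) < e})" by blast
      moreover have "V = carrier SL2C \<inter> \<dots>" by (auto simp: V_def)
      ultimately show ?thesis by (simp only: openin_open_Int)
    qed
    ultimately have "openin PSL2C_topology U" by (auto simp: openin_PSL2C U_def)
    moreover have "U \<inter> G = {x}"
    proof (intro equalityI subsetI)
      fix y assume y: "y \<in> U \<inter> G"
      then obtain Y where Y: "y = {Y, - Y}" "det Y = 1" by (auto simp: U_def carrier_PSL2C)
      have "Y \<in> V" using y Y by (auto simp: U_def)
      have "inv\<^bsub>PSL2C\<^esub> x \<otimes>\<^bsub>PSL2C\<^esub> y \<in> G" using x y by auto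
      then have AY: "{A ** Y, - (A ** Y)} \<in> G" unfolding A(1) Y(1) using A(2) Y(2) by (simp add: mult_PSL2C)
      then have AY': "{- (A ** Y), - (- (A ** Y))} \<in> G" by (simp add: insert_commute)
      have "A ** Y = mat 1 \<or> A ** Y = - mat 1"
      proof -
        have "dist (A ** Y) (mat 1) < e \<or> dist (- (A ** Y)) (mat 1) < e"
          using \<open>Y \<in> V\<close> by (simp add: V_def neg_mult)
        then show ?thesis
          using e(2)[OF AY] e(2)[OF AY'] minus_equation_iff[of "A ** Y" "mat 1"] by auto
      qed
      then have "inv\<^bsub>PSL2C\<^esub> x \<otimes>\<^bsub>PSL2C\<^esub> y = \<one>\<^bsub>PSL2C\<^esub>"
        unfolding A(1) Y(1) mult_PSL2C[OF A(2) Y(2)] one_PSL2C by auto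
      then have "y = x \<otimes>\<^bsub>PSL2C\<^esub> \<one>\<^bsub>PSL2C\<^esub>"
        using x y G.mem_carrier P.inv_solve_left'[of "\<one>\<^bsub>PSL2C\<^esub>" x y] by simp
      then show "y \<in> {x}" using G.mem_carrier[OF x] by simp
    next
      fix y assume "y \<in> {x}"
      then have [simp]: "y = x" by simp
      obtain X where X: "x = {X, - X}" "det X = 1" using G.mem_carrier[OF x] by (auto simp: carrier_PSL2C)
      have "inv\<^bsub>PSL2C\<^esub> x \<otimes>\<^bsub>PSL2C\<^esub> x = \<one>\<^bsub>PSL2C\<^esub>" using G.mem_carrier[OF x] by simp
      moreover have "{A ** X, - (A ** X)} = inv\<^bsub>PSL2C\<^esub> x \<otimes>\<^bsub>PSL2C\<^esub> x"
        by (subst A(1), subst X(1), rule mult_PSL2C[OF A(2) X(2), symmetric])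
      ultimately have "{A ** X, - (A ** X)} = {mat 1, - mat 1}" by (simp only: one_PSL2C)
      then have "A ** X = mat 1 \<or> - (A ** X) = mat 1" by (metis insertI1 insertE singletonD)
      then have "X \<in> V" using e(1) X(2) by (auto simp: V_def SL2C_def neg_mult)
      then have "x \<in> U" using V_neg[of X] X G.mem_carrier[OF x] by (auto simp: U_def)
      then show "y \<in> U \<inter> G" using x by simp
    qed
    ultimately show ?thesis unfolding openin_subtopology by blast
  qed
  then have "discrete_topology G = subtopology PSL2C_topology G"
    using G.subset by (subst discrete_topology_unique) (auto simp: topspace_PSL2C)
  then show "discrete_in_PSL2C G" unfolding discrete_in_PSL2C_def by simp
qed

section \<open>Words in two elements\<close>

text \<open>The entries \<open>(a, c)\<close> represent the matrix with rows \<open>(a, c)\<close> and \<open>(cnj c, cnj a)\<close>. Working with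
  the entries makes products of generators polynomial in four complex numbers and their conjugates.\<close>

definition entries_mult :: "complex \<times> complex \<Rightarrow> complex \<times> complex \<Rightarrow> complex \<times> complex" where
  "entries_mult x y = (fst x * fst y + snd x * cnj (snd y), fst x * snd y + snd x * cnj (fst y))"

definition entries_inv :: "complex \<times> complex \<Rightarrow> complex \<times> complex" where
  "entries_inv x = (cnj (fst x), - snd x)"

definition unimodular :: "complex \<times> complex \<Rightarrow> bool" where
  "unimodular x \<longleftrightarrow> (cmod (fst x))\<^sup>2 - (cmod (snd x))\<^sup>2 = 1"

definition elem_of :: "complex \<times> complex \<Rightarrow> (complex^2^2) set" where
  "elem_of x = disk_elem (fst x) (snd x)"

text \<open>In a letter, the first component selects one of the two elements \<open>x\<close> and \<open>y\<close>, and the second is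
  \<open>False\<close> when its inverse is meant. As the letters do not depend on \<open>x\<close> and \<open>y\<close>, there are
  countably many words.\<close>

definition letter_val where
  "letter_val x y l = (let z = if fst l then x else y in if snd l then z else entries_inv z)"

primrec word_val where
  "word_val x y [] = (1, 0)"
| "word_val x y (l # w) = entries_mult (letter_val x y l) (word_val x y w)"

definition letter_inv :: "bool \<times> bool \<Rightarrow> bool \<times> bool" where
  "letter_inv l = (fst l, \<not> snd l)"

lemma disk_matrix_mult:
  "disk_matrix (fst x) (snd x) ** disk_matrix (fst y) (snd y)
    = disk_matrix (fst (entries_mult x y)) (snd (entries_mult x y))"
  by (simp add: vec_eq_iff forall_2 matrix_matrix_mult_def sum_2 algebra_simps entries_mult_def)

lemma unimodular_det: "unimodular x \<longleftrightarrow> det (disk_matrix (fst x) (snd x)) = 1"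
  unfolding det_disk_matrix unimodular_def by (metis of_real_1 of_real_eq_iff)

lemma unimodular_mult: "unimodular x \<Longrightarrow> unimodular y \<Longrightarrow> unimodular (entries_mult x y)"
  by (simp add: unimodular_det disk_matrix_mult[symmetric] det_mul)

lemma unimodular_inv: "unimodular x \<Longrightarrow> unimodular (entries_inv x)"
  by (simp add: unimodular_def entries_inv_def)

lemma unimodular_complex: "unimodular x \<Longrightarrow> fst x * cnj (fst x) - snd x * cnj (snd x) = 1"
  unfolding unimodular_def
  by (metis complex_norm_square of_real_1 of_real_diff)

lemma entries_mult_assoc:
  "entries_mult (entries_mult x y) z = entries_mult x (entries_mult y z)"
  by (simp add: entries_mult_def algebra_simps)

lemma entries_mult_one [simp]: "entries_mult (1, 0) x = x" "entries_mult x (1, 0) = x"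
  by (simp_all add: entries_mult_def)

lemma entries_mult_inv: "unimodular x \<Longrightarrow> entries_mult x (entries_inv x) = (1, 0)"
  "unimodular x \<Longrightarrow> entries_mult (entries_inv x) x = (1, 0)"
  using unimodular_complex[of x]
  by (simp_all add: entries_mult_def entries_inv_def algebra_simps)

lemma elem_of_mult:
  "unimodular x \<Longrightarrow> unimodular y \<Longrightarrow> elem_of x \<otimes>\<^bsub>PSL2C\<^esub> elem_of y = elem_of (entries_mult x y)"
  by (simp add: elem_of_def disk_elem_eq unimodular_det mult_PSL2C disk_matrix_mult)

lemma elem_of_one: "elem_of (1, 0) = \<one>\<^bsub>PSL2C\<^esub>"
  by (auto simp: elem_of_def one_PSL2C disk_elem_eq vec_eq_iff forall_2 mat_def)

lemma elem_of_carrier: "unimodular x \<Longrightarrow> elem_of x \<in> carrier PSL2C"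
  by (auto simp: elem_of_def carrier_PSL2C disk_elem_eq unimodular_det)

lemma elem_of_inv:
  assumes "unimodular x" shows "inv\<^bsub>PSL2C\<^esub> (elem_of x) = elem_of (entries_inv x)"
proof -
  interpret P: group PSL2C by (rule group_PSL2C)
  show ?thesis
    by (rule P.inv_equality)
      (simp_all add: assms elem_of_mult unimodular_inv elem_of_carrier entries_mult_inv elem_of_one)
qed

lemma unimodular_letter:
  "unimodular x \<Longrightarrow> unimodular y \<Longrightarrow> unimodular (letter_val x y l)"
  by (simp add: letter_val_def Let_def unimodular_inv)

lemma unimodular_word:
  "unimodular x \<Longrightarrow> unimodular y \<Longrightarrow> unimodular (word_val x y w)"
proof (induction w)
  case Nil
  show ?case by (simp add: unimodular_def)
qed (simp add: unimodular_mult unimodular_letter)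

lemma word_val_append: "word_val x y (v @ w) = entries_mult (word_val x y v) (word_val x y w)"
  by (induction v) (simp_all add: entries_mult_assoc)

lemma generate_eq_words:
  assumes "unimodular x" "unimodular y"
  shows "generate PSL2C {elem_of x, elem_of y} = range (\<lambda>w. elem_of (word_val x y w))"
proof (intro equalityI subsetI)
  fix h assume "h \<in> generate PSL2C {elem_of x, elem_of y}"
  then show "h \<in> range (\<lambda>w. elem_of (word_val x y w))"
  proof induction
    case one
    show ?case by (rule range_eqI[of _ _ "[]"]) (simp add: elem_of_one)
  next
    case (incl h)
    \<comment> \<open>The letter stands for the first element if \<open>h\<close> equals it, and for the second one otherwise.\<close>
    then have "h = elem_of (word_val x y [(h = elem_of x, True)])" by (auto simp: letter_val_def)
    then show ?case by (rule range_eqI)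
  next
    case (inv h)
    then have "inv\<^bsub>PSL2C\<^esub> h = elem_of (word_val x y [(h = elem_of x, False)])"
      using assms by (auto simp: letter_val_def elem_of_inv)
    then show ?case by (rule range_eqI)
  next
    case (eng h1 h2)
    then obtain v w where "h1 = elem_of (word_val x y v)" "h2 = elem_of (word_val x y w)" by blast
    then have "h1 \<otimes>\<^bsub>PSL2C\<^esub> h2 = elem_of (word_val x y (v @ w))"
      using assms by (simp add: elem_of_mult unimodular_word word_val_append)
    then show ?case by (rule range_eqI)
  qed
next
  fix h assume "h \<in> range (\<lambda>w. elem_of (word_val x y w))"
  then obtain w where "h = elem_of (word_val x y w)" by blast
  moreover have "elem_of (word_val x y w) \<in> generate PSL2C {elem_of x, elem_of y}"
  proof (induction w)
    case Nil
    show ?case by (simp add: elem_of_one generate.one)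
  next
    case (Cons l w)
    have "elem_of (letter_val x y l) \<in> generate PSL2C {elem_of x, elem_of y}"
      using assms generate.incl[of "elem_of x" "{elem_of x, elem_of y}" PSL2C]
       generate.incl[of "elem_of y" "{elem_of x, elem_of y}" PSL2C]
       generate.inv[of "elem_of x" "{elem_of x, elem_of y}" PSL2C]
       generate.inv[of "elem_of y" "{elem_of x, elem_of y}" PSL2C]
      by (simp add: letter_val_def elem_of_inv)
    then show ?case
      using generate.eng[OF _ Cons] assms by (simp add: elem_of_mult[symmetric] unimodular_word unimodular_letter)
  qed
  ultimately show "h \<in> generate PSL2C {elem_of x, elem_of y}" by simp
qed

lemma dist_disk_matrix_one: "(dist (disk_matrix p q) (mat 1))\<^sup>2 = 2 * (dist p 1)\<^sup>2 + 2 * (cmod q)\<^sup>2"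
proof -
  have "cmod (cnj p - 1) = cmod (p - 1)"
    by (metis complex_cnj_diff complex_cnj_one complex_mod_cnj)
  then show ?thesis
  by (simp add: dist_norm norm_vec_def L2_set_def sum_2 mat_def)
qed

text \<open>The two quantities compared with \<open>e\<close> are the squared distances of the matrix and of its negative,
  which represents the same coset, from the identity matrix.\<close>

definition away_from_one :: "real \<Rightarrow> complex \<times> complex \<Rightarrow> bool" where
  "away_from_one e x \<longleftrightarrow> x = (1, 0) \<or> x = (- 1, 0) \<or>
     e \<le> 2 * (dist (fst x) 1)\<^sup>2 + 2 * (cmod (snd x))\<^sup>2 \<and> e \<le> 2 * (dist (- fst x) 1)\<^sup>2 + 2 * (cmod (snd x))\<^sup>2"

lemma disk_matrix_eq_one: "disk_matrix p q = mat 1 \<longleftrightarrow> p = 1 \<and> q = 0"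
  "disk_matrix p q = - mat 1 \<longleftrightarrow> p = - 1 \<and> q = 0"
  by (auto simp: vec_eq_iff forall_2 mat_def)

lemma disk_matrix_uminus: "- disk_matrix p q = disk_matrix (- p) (- q)"
  by (simp add: vec_eq_iff forall_2)

text \<open>Both quantifiers on the right range over countable sets, which is what makes discreteness a
  measurable event.\<close>

lemma discrete_iff_words:
  assumes "unimodular x" "unimodular y"
  shows "discrete_in_PSL2C (generate PSL2C {elem_of x, elem_of y}) \<longleftrightarrow>
     (\<exists>n. \<forall>w. away_from_one (1 / real (Suc n)) (word_val x y w))"
proof -
  interpret P: group PSL2C by (rule group_PSL2C)
  let ?G = "generate PSL2C {elem_of x, elem_of y}"
  have sub: "subgroup ?G PSL2C"
    using assms by (intro P.generate_is_subgroup) (auto simp: elem_of_carrier)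
  show ?thesis
    unfolding discrete_iff_isolated_identity[OF sub]
  proof
    assume "\<exists>e>0. \<forall>X. {X, - X} \<in> ?G \<longrightarrow> dist X (mat 1) < e \<longrightarrow> X = mat 1 \<or> X = - mat 1"
    then obtain e where e: "e > 0"
      "\<And>X. {X, - X} \<in> ?G \<Longrightarrow> dist X (mat 1) < e \<Longrightarrow> X = mat 1 \<or> X = - mat 1" by blast
    obtain n where n: "1 / real (Suc n) < e\<^sup>2"
      using e(1) by (metis nat_approx_posE zero_less_power)
    have "away_from_one (1 / real (Suc n)) (word_val x y w)" for w
    proof -
      define p q where pq: "p = fst (word_val x y w)" "q = snd (word_val x y w)"
      then have w: "word_val x y w = (p, q)" by simp
      have "elem_of (word_val x y w) \<in> ?G" by (simp add: generate_eq_words assms)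
      then have 1: "{disk_matrix p q, - disk_matrix p q} \<in> ?G" by (simp add: elem_of_def disk_elem_eq w)
      then have 2: "{disk_matrix (-p) (-q), - disk_matrix (-p) (-q)} \<in> ?G"
        by (simp add: disk_matrix_uminus insert_commute)
      show ?thesis
      proof (cases "(p, q) \<in> {(1, 0), (- 1, 0)}")
        case False
        then have "\<not> dist (disk_matrix p q) (mat 1) < e" "\<not> dist (disk_matrix (-p) (-q)) (mat 1) < e"
          using e(2)[OF 1] e(2)[OF 2] minus_equation_iff[of p 1] by (auto simp: disk_matrix_eq_one)
        then have "e\<^sup>2 \<le> (dist (disk_matrix p q) (mat 1))\<^sup>2" "e\<^sup>2 \<le> (dist (disk_matrix (-p) (-q)) (mat 1))\<^sup>2"
          using e(1) by (auto intro!: power_mono)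
        then show ?thesis using n by (simp add: away_from_one_def w dist_disk_matrix_one)
      qed (auto simp: away_from_one_def w)
    qed
    then show "\<exists>n. \<forall>w. away_from_one (1 / real (Suc n)) (word_val x y w)" by blast
  next
    assume "\<exists>n. \<forall>w. away_from_one (1 / real (Suc n)) (word_val x y w)"
    then obtain n where n: "\<And>w. away_from_one (1 / real (Suc n)) (word_val x y w)" by blast
    show "\<exists>e>0. \<forall>X. {X, - X} \<in> ?G \<longrightarrow> dist X (mat 1) < e \<longrightarrow> X = mat 1 \<or> X = - mat 1"
    proof (intro exI[of _ "sqrt (1 / real (Suc n))"] conjI allI impI)
      fix X assume X: "{X, - X} \<in> ?G" "dist X (mat 1) < sqrt (1 / real (Suc n))"
      then have d: "(dist X (mat 1))\<^sup>2 < 1 / real (Suc n)"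
        by (metis real_sqrt_less_iff real_sqrt_abs abs_of_nonneg zero_le_dist)
      obtain w where w: "{X, - X} = elem_of (word_val x y w)"
        using X(1) by (auto simp: generate_eq_words assms)
      define p q where pq: "p = fst (word_val x y w)" "q = snd (word_val x y w)"
      then have wpq: "word_val x y w = (p, q)" by simp
      have "X = disk_matrix p q \<or> X = disk_matrix (-p) (-q)"
        using w by (auto simp: elem_of_def disk_elem_eq wpq doubleton_eq_iff disk_matrix_uminus)
      then show "X = mat 1 \<or> X = - mat 1"
        using d n[of w] by (auto simp: disk_matrix_eq_one wpq away_from_one_def dist_disk_matrix_one)
    qed simp
  qed
qed

lemma word_val_measurable:
  assumes [measurable]: "(\<lambda>\<omega>. fst (x \<omega>)) \<in> borel_measurable M" "(\<lambda>\<omega>. snd (x \<omega>)) \<in> borel_measurable M"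
    "(\<lambda>\<omega>. fst (y \<omega>)) \<in> borel_measurable M" "(\<lambda>\<omega>. snd (y \<omega>)) \<in> borel_measurable M"
  shows "(\<lambda>\<omega>. fst (word_val (x \<omega>) (y \<omega>) w)) \<in> borel_measurable M
    \<and> (\<lambda>\<omega>. snd (word_val (x \<omega>) (y \<omega>) w)) \<in> borel_measurable M"
proof (induction w)
  case (Cons l w)
  note Cons[THEN conjunct1, measurable] Cons[THEN conjunct2, measurable]
  have [measurable]: "cnj \<in> borel_measurable borel"
    by (intro borel_measurable_continuous_onI continuous_intros)
  have [measurable]: "(\<lambda>\<omega>. fst (letter_val (x \<omega>) (y \<omega>) l)) \<in> borel_measurable M"
    "(\<lambda>\<omega>. snd (letter_val (x \<omega>) (y \<omega>) l)) \<in> borel_measurable M"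
    unfolding letter_val_def entries_inv_def Let_def
    by (cases "fst l"; cases "snd l"; simp; measurable)+
  show ?case unfolding word_val.simps entries_mult_def fst_conv snd_conv by (intro conjI; measurable)
qed simp

lemma discrete_event_measurable:
  assumes "(\<lambda>\<omega>. fst (x \<omega>)) \<in> borel_measurable M" "(\<lambda>\<omega>. snd (x \<omega>)) \<in> borel_measurable M"
    "(\<lambda>\<omega>. fst (y \<omega>)) \<in> borel_measurable M" "(\<lambda>\<omega>. snd (y \<omega>)) \<in> borel_measurable M"
    and "\<And>\<omega>. \<omega> \<in> space M \<Longrightarrow> unimodular (x \<omega>)" "\<And>\<omega>. \<omega> \<in> space M \<Longrightarrow> unimodular (y \<omega>)"
  shows "{\<omega> \<in> space M. discrete_in_PSL2C (generate PSL2C {elem_of (x \<omega>), elem_of (y \<omega>)})} \<in> sets M"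
proof -
  have [measurable]: "(\<lambda>\<omega>. fst (word_val (x \<omega>) (y \<omega>) w)) \<in> borel_measurable M"
    "(\<lambda>\<omega>. snd (word_val (x \<omega>) (y \<omega>) w)) \<in> borel_measurable M" for w
    using word_val_measurable[OF assms(1-4)] by blast+
  have "{\<omega> \<in> space M. discrete_in_PSL2C (generate PSL2C {elem_of (x \<omega>), elem_of (y \<omega>)})}
    = {\<omega> \<in> space M. \<exists>n. \<forall>w. away_from_one (1 / real (Suc n)) (word_val (x \<omega>) (y \<omega>) w)}"
    by (intro Collect_cong conj_cong refl discrete_iff_words assms(5,6))
  also have "\<dots> \<in> sets M" unfolding away_from_one_def prod_eq_iff fst_conv snd_conv by measurable
  finally show ?thesis .
qed

definition reduced :: "(bool \<times> bool) list \<Rightarrow> bool" where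
  "reduced w \<longleftrightarrow> successively (\<lambda>l m. m \<noteq> letter_inv l) w"

lemma letter_val_inv: "letter_val x y (letter_inv l) = entries_inv (letter_val x y l)"
  by (simp add: letter_val_def letter_inv_def entries_inv_def Let_def)

text \<open>Cancelling adjacent inverse letters does not change the value. The ping-pong argument needs
  reduced words, because a letter is only controlled on the exterior of the disk of its inverse.\<close>

lemma exists_reduced_word:
  assumes "unimodular x" "unimodular y"
  shows "\<exists>v. reduced v \<and> word_val x y v = word_val x y w"
proof (induction w)
  case Nil
  show ?case by (intro exI[of _ "[]"]) (simp add: reduced_def)
next
  case (Cons l w)
  then obtain v where v: "reduced v" "word_val x y v = word_val x y w" by blast
  show ?case
  proof (cases v)
    case Nil
    then show ?thesis using v by (intro exI[of _ "[l]"]) (simp add: reduced_def)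
  next
    case v': (Cons m u)
    show ?thesis
    proof (cases "m = letter_inv l")
      case True
      have "word_val x y (l # w) = entries_mult (letter_val x y l) (word_val x y v)"
        by (simp add: v(2))
      also have "\<dots> = word_val x y u"
        using assms by (simp add: v' True letter_val_inv entries_mult_assoc[symmetric]
            entries_mult_inv unimodular_letter)
      finally show ?thesis
        using v(1) by (intro exI[of _ u]) (auto simp: reduced_def v' successively_Cons)
    next
      case False
      then show ?thesis
        using v by (intro exI[of _ "l # v"]) (simp add: reduced_def v' del: word_val.simps(2), simp)
    qed
  qed
qed

section \<open>Ping-pong on isometric disks\<close>

text \<open>For \<open>x = (a, c)\<close> with \<open>c \<noteq> 0\<close> the disk meant here is the isometric disk \<open>\<bar>a - cnj c * w\<bar> \<le> 1\<close> of
  the inverse of \<open>x\<close>, into which \<open>x\<close> moves the exterior of its own isometric disk. The point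
  tested is the image \<open>w = q / cnj p\<close> of the origin under \<open>z = (p, q)\<close>; the inequality is
  multiplied by the modulus of \<open>p\<close>.\<close>

definition in_disk :: "complex \<times> complex \<Rightarrow> complex \<times> complex \<Rightarrow> bool" where
  "in_disk x z \<longleftrightarrow> cmod (fst x * cnj (fst z) - cnj (snd x) * snd z) \<le> cmod (fst z)"

definition in_open_disk :: "complex \<times> complex \<Rightarrow> complex \<times> complex \<Rightarrow> bool" where
  "in_open_disk x z \<longleftrightarrow> cmod (fst x * cnj (fst z) - cnj (snd x) * snd z) < cmod (fst z)"

text \<open>The disk of \<open>(a, c)\<close> has centre \<open>a / cnj c\<close> and radius \<open>1 / \<bar>c\<bar>\<close>. The condition says that the
  distance of the centres is at least the sum of the radii, multiplied by both moduli \<open>\<bar>c\<bar>\<close>, so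
  that tangent disks are allowed.\<close>

definition disjoint_disks :: "complex \<times> complex \<Rightarrow> complex \<times> complex \<Rightarrow> bool" where
  "disjoint_disks x y \<longleftrightarrow>
    cmod (snd x) + cmod (snd y) \<le> cmod (fst x * cnj (snd y) - fst y * cnj (snd x))"

text \<open>The triangle inequality for the two centres and the tested point; since one of the two disks is open, it is
  contradicted even if the disks are tangent.\<close>

lemma not_in_disjoint_disk:
  assumes "disjoint_disks x y" "snd x \<noteq> 0" "in_disk x z"
  shows "\<not> in_open_disk y z"
proof
  assume y: "in_open_disk y z"
  let ?p = "fst z" and ?q = "snd z"
  have "(cmod (snd x) + cmod (snd y)) * cmod ?p
      \<le> cmod (fst x * cnj (snd y) - fst y * cnj (snd x)) * cmod ?p"
    using assms(1) unfolding disjoint_disks_def by (rule mult_right_mono) simp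
  also have "\<dots> = cmod (cnj (snd y) * (fst x * cnj ?p - cnj (snd x) * ?q)
          - cnj (snd x) * (fst y * cnj ?p - cnj (snd y) * ?q))"
    by (subst complex_mod_cnj[of ?p, symmetric], subst norm_mult[symmetric])
      (simp add: algebra_simps)
  also have "\<dots> \<le> cmod (snd y) * cmod (fst x * cnj ?p - cnj (snd x) * ?q)
      + cmod (snd x) * cmod (fst y * cnj ?p - cnj (snd y) * ?q)"
    by (rule order_trans[OF norm_triangle_ineq4]) (simp add: norm_mult)
  also have "\<dots> < cmod (snd y) * cmod ?p + cmod (snd x) * cmod ?p"
    using assms(2,3) y unfolding in_disk_def in_open_disk_def
    by (intro add_le_less_mono mult_left_mono mult_strict_left_mono) auto
  finally show False by (simp add: algebra_simps)
qed

text \<open>With \<open>f z = (a * z + c) / (cnj c * z + cnj a)\<close> the reason is the identity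
  \<open>a - cnj c * f z = 1 / (cnj c * z + cnj a)\<close>, which uses that the determinant is \<open>1\<close>.\<close>

lemma maps_exterior_into_disk:
  assumes "unimodular x" "\<not> in_open_disk (entries_inv x) z"
  shows "in_disk x (entries_mult x z)"
proof -
  have "fst x * cnj (fst (entries_mult x z)) - cnj (snd x) * snd (entries_mult x z)
     = (fst x * cnj (fst x) - snd x * cnj (snd x)) * cnj (fst z)"
    by (simp add: entries_mult_def algebra_simps)
  also have "\<dots> = cnj (fst z)" by (simp add: unimodular_complex assms)
  finally have "cmod (fst x * cnj (fst (entries_mult x z)) - cnj (snd x) * snd (entries_mult x z))
     = cmod (fst z)" by simp
  also have "\<dots> \<le> cmod (cnj (fst x) * cnj (fst z) + cnj (snd x) * snd z)"
    using assms(2) by (simp add: in_open_disk_def entries_inv_def)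
  also have "\<dots> = cmod (cnj (fst (entries_mult x z)))"
    by (simp add: entries_mult_def)
  finally show ?thesis by (simp add: in_disk_def)
qed

lemma unimodular_ge_one:
  assumes "unimodular x"
  shows "1 \<le> cmod (fst x)"
proof (rule power2_le_imp_le)
  show "1\<^sup>2 \<le> (cmod (fst x))\<^sup>2"
    using assms zero_le_power2[of "cmod (snd x)"] unfolding unimodular_def one_power2 by linarith
qed simp

text \<open>The ping-pong argument. The rest of the word moves the origin into the closed disk of its first
  letter. As that letter is not the inverse of \<open>l\<close>, this point is outside the open
  isometric disk of \<open>l\<close>, so \<open>l\<close> moves it into the disk of \<open>l\<close>.\<close>

lemma reduced_word_in_disk:
  assumes "unimodular x" "unimodular y"
    and disj: "\<And>l m. l \<noteq> m \<Longrightarrow> disjoint_disks (letter_val x y l) (letter_val x y m)"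
    and nz: "\<And>l. snd (letter_val x y l) \<noteq> 0"
    and "reduced (l # w)"
  shows "in_disk (letter_val x y l) (word_val x y (l # w))"
  using \<open>reduced (l # w)\<close>
proof (induction w arbitrary: l)
  case Nil
  have u: "unimodular (letter_val x y l)" by (intro unimodular_letter assms)
  show ?case
    using unimodular_complex[OF u] unimodular_ge_one[OF u] by (simp add: in_disk_def mult.commute)
next
  case (Cons m w)
  have u: "unimodular (letter_val x y l)" by (intro unimodular_letter assms)
  have r: "reduced (m # w)" "m \<noteq> letter_inv l" using Cons.prems by (auto simp: reduced_def)
  have "\<not> in_open_disk (letter_val x y (letter_inv l)) (word_val x y (m # w))"
    by (intro not_in_disjoint_disk[OF disj[OF r(2)] nz Cons.IH[OF r(1)]])
  then show ?case
    unfolding letter_val_inv word_val.simps(2)[of x y l] by (intro maps_exterior_into_disk u)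
qed

text \<open>The disk of \<open>(a, c)\<close> has distance \<open>(\<bar>a\<bar> - 1) / \<bar>c\<bar>\<close> from the origin, and the point
  \<open>q / cnj p\<close> has modulus at most \<open>\<bar>q\<bar>\<close>.\<close>

lemma in_disk_lower_bound:
  assumes "unimodular x" "unimodular z" "in_disk x z"
  shows "cmod (fst x) - 1 \<le> cmod (snd x) * cmod (snd z)"
proof -
  have "cmod (fst x) * cmod (fst z) - cmod (snd x) * cmod (snd z)
      \<le> cmod (fst x * cnj (fst z) - cnj (snd x) * snd z)"
    using norm_triangle_ineq2[of "fst x * cnj (fst z)" "cnj (snd x) * snd z"] by (simp add: norm_mult)
  also have "\<dots> \<le> cmod (fst z)" using assms(3) by (simp add: in_disk_def)
  finally have "(cmod (fst x) - 1) * cmod (fst z) \<le> cmod (snd x) * cmod (snd z)"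
    by (simp add: algebra_simps)
  moreover have "(cmod (fst x) - 1) * 1 \<le> (cmod (fst x) - 1) * cmod (fst z)"
    using unimodular_ge_one[OF assms(1)] unimodular_ge_one[OF assms(2)] by (intro mult_left_mono) auto
  ultimately show ?thesis by simp
qed

text \<open>A nonempty reduced word has an off-diagonal entry bounded below by the least distance from the origin to one of
  the four disks; this distance is positive since the disks do not contain the origin.\<close>

lemma discrete_if_disjoint_disks:
  assumes "unimodular x" "unimodular y" "snd x \<noteq> 0" "snd y \<noteq> 0"
    and disj: "\<And>l m. l \<noteq> m \<Longrightarrow> disjoint_disks (letter_val x y l) (letter_val x y m)"
  shows "discrete_in_PSL2C (generate PSL2C {elem_of x, elem_of y})"
proof -
  have nz: "snd (letter_val x y l) \<noteq> 0" for l
    using assms(3,4) by (simp add: letter_val_def entries_inv_def)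
  define h where "h l = (cmod (fst (letter_val x y l)) - 1) / cmod (snd (letter_val x y l))" for l
  have h: "h l > 0" for l
  proof -
    have "unimodular (letter_val x y l)" by (intro unimodular_letter assms)
    then have "(cmod (fst (letter_val x y l)))\<^sup>2 > 1" "1 \<le> cmod (fst (letter_val x y l))"
      using nz[of l] unimodular_ge_one by (auto simp: unimodular_def algebra_simps)
    then have "cmod (fst (letter_val x y l)) > 1" by (cases "cmod (fst (letter_val x y l)) = 1") auto
    then show ?thesis using nz[of l] by (simp add: h_def)
  qed
  define e where "e = Min (range h)"
  have e: "e > 0" "\<And>l. e \<le> h l" using h by (simp_all add: e_def)
  obtain n where n: "1 / real (Suc n) < e\<^sup>2"
    using e(1) by (metis nat_approx_posE zero_less_power)
  have "away_from_one (1 / real (Suc n)) (word_val x y w)" for w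
  proof -
    obtain v where v: "reduced v" "word_val x y v = word_val x y w"
      using exists_reduced_word assms(1,2) by blast
    show ?thesis
    proof (cases v)
      case Nil
      then show ?thesis using v(2) by (simp add: away_from_one_def)
    next
      case (Cons l u)
      let ?z = "word_val x y w"
      have "in_disk (letter_val x y l) ?z"
        unfolding v(2)[symmetric] Cons using v(1)
        by (intro reduced_word_in_disk assms nz) (simp_all add: Cons)
      then have "cmod (fst (letter_val x y l)) - 1 \<le> cmod (snd (letter_val x y l)) * cmod (snd ?z)"
        by (intro in_disk_lower_bound unimodular_letter unimodular_word assms)
      then have "h l \<le> cmod (snd ?z)" using nz[of l] by (simp add: h_def divide_simps mult.commute)
      then have "e\<^sup>2 \<le> (cmod (snd ?z))\<^sup>2" using e(1) e(2)[of l] by (intro power_mono) auto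
      moreover have "0 \<le> (dist (fst ?z) 1)\<^sup>2" "0 \<le> (dist (- fst ?z) 1)\<^sup>2" by auto
      ultimately show ?thesis unfolding away_from_one_def using n zero_le_power2[of "cmod (snd ?z)"] by (intro disjI2 conjI; linarith)
    qed
  qed
  then show ?thesis using assms by (auto simp: discrete_iff_words)
qed

section \<open>Placing four arcs on the circle\<close>

lemma cos_le_cos_if_farther:
  assumes "0 \<le> m" "m \<le> t" "t \<le> 2 * pi - m"
  shows "cos t \<le> cos m"
proof (cases "t \<le> pi")
  case True
  then show ?thesis using assms by (intro cos_monotone_0_pi_le) auto
next
  case False
  have "cos (2 * pi - t) \<le> cos m" using assms False by (intro cos_monotone_0_pi_le) auto
  then show ?thesis by simp
qed

lemma cos_le_cos_if_abs_farther:
  assumes "0 \<le> m" "m \<le> \<bar>t\<bar>" "\<bar>t\<bar> \<le> 2 * pi - m"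
  shows "cos t \<le> cos m"
  using cos_le_cos_if_farther[OF assms] by simp

text \<open>Four points on the unit circle, the first one rotated to \<open>1\<close>, followed by \<open>x\<close>, \<open>y\<close>, \<open>z\<close>. They are
  the midpoints of arcs of lengths \<open>\<theta>\<close>, \<open>\<theta>\<close>, \<open>\<phi>\<close>, \<open>\<phi>\<close>. For lengths in \<open>[0, \<pi>]\<close>, two arcs
  overlap at most in endpoints if and only if the angle between the midpoints is at least half the sum of the lengths,
  and the real parts are the cosines of these angles.\<close>

definition separated :: "real \<Rightarrow> real \<Rightarrow> complex \<Rightarrow> complex \<Rightarrow> complex \<Rightarrow> bool" where
  "separated \<theta> \<phi> x y z \<longleftrightarrow> Re x \<le> cos \<theta> \<and> Re y \<le> cos ((\<theta> + \<phi>) / 2) \<and> Re z \<le> cos ((\<theta> + \<phi>) / 2) \<and>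
    Re (y * cnj x) \<le> cos ((\<theta> + \<phi>) / 2) \<and> Re (z * cnj x) \<le> cos ((\<theta> + \<phi>) / 2) \<and> Re (z * cnj y) \<le> cos \<phi>"

definition centres :: "real \<Rightarrow> real \<Rightarrow> (real \<times> real \<times> real) set" where
  "centres \<theta> \<phi> = {(x, y, z). x \<in> {0..2 * pi} \<and> y \<in> {0..2 * pi} \<and> z \<in> {0..2 * pi} \<and>
     separated \<theta> \<phi> (cis x) (cis y) (cis z)}"

lemma centresI:
  assumes "0 \<le> \<theta>" "0 \<le> \<phi>"
    and "\<theta> \<le> x" "x \<le> 2 * pi - \<theta>"
    and "(\<theta> + \<phi>) / 2 \<le> y" "y \<le> 2 * pi - (\<theta> + \<phi>) / 2"
    and "(\<theta> + \<phi>) / 2 \<le> z" "z \<le> 2 * pi - (\<theta> + \<phi>) / 2"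
    and "(\<theta> + \<phi>) / 2 \<le> \<bar>y - x\<bar>" "\<bar>y - x\<bar> \<le> 2 * pi - (\<theta> + \<phi>) / 2"
    and "(\<theta> + \<phi>) / 2 \<le> \<bar>z - x\<bar>" "\<bar>z - x\<bar> \<le> 2 * pi - (\<theta> + \<phi>) / 2"
    and "\<phi> \<le> \<bar>z - y\<bar>" "\<bar>z - y\<bar> \<le> 2 * pi - \<phi>"
  shows "(x, y, z) \<in> centres \<theta> \<phi>"
proof -
  have "cis s * cnj (cis t) = cis (s - t)" for s t by (simp add: cis_cnj cis_mult)
  moreover have "x \<in> {0..2 * pi}" "y \<in> {0..2 * pi}" "z \<in> {0..2 * pi}"
    using assms by (auto simp: field_simps)
  ultimately show ?thesis
    unfolding centres_def separated_def using assms
    by (auto intro!: cos_le_cos_if_farther cos_le_cos_if_abs_farther)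
qed

text \<open>The three comparisons determine in which order the arcs follow each other around the circle from
  the first arc. Ties are broken in a fixed way, so that the order types partition the whole space.\<close>

definition order_type :: "real \<times> real \<times> real \<Rightarrow> bool \<times> bool \<times> bool" where
  "order_type p = (case p of (x, y, z) \<Rightarrow> (x \<le> y, y \<le> z, x \<le> z))"

text \<open>The displacement of the midpoints when the four arcs, collapsed to points, are opened again to
  their full length: a midpoint moves by half the first arc, half its own arc, and the full length of every arc
  that lies in between.\<close>

definition opening_shift :: "real \<Rightarrow> real \<Rightarrow> bool \<times> bool \<times> bool \<Rightarrow> real \<times> real \<times> real" where
  "opening_shift \<theta> \<phi> i = (case i of (xy, yz, xz) \<Rightarrow>
     (\<theta> + of_bool (\<not> xy) * \<phi> + of_bool (\<not> xz) * \<phi>,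
      (\<theta> + \<phi>) / 2 + of_bool xy * \<theta> + of_bool (\<not> yz) * \<phi>,
      (\<theta> + \<phi>) / 2 + of_bool xz * \<theta> + of_bool yz * \<phi>))"

lemma opening_shift_separates:
  assumes "0 \<le> \<theta>" "0 \<le> \<phi>"
    and p: "p \<in> {0<..<D} \<times> {0<..<D} \<times> {0<..<D}"
    and D: "D = 2 * pi - 2 * \<theta> - 2 * \<phi>"
  shows "opening_shift \<theta> \<phi> (order_type p) + p \<in> centres \<theta> \<phi>"
    "order_type (opening_shift \<theta> \<phi> (order_type p) + p) = order_type p"
proof -
  obtain x y z where [simp]: "p = (x, y, z)" by (cases p)
  have p': "0 < x" "x < D" "0 < y" "y < D" "0 < z" "z < D" using p by auto
  show "opening_shift \<theta> \<phi> (order_type p) + p \<in> centres \<theta> \<phi>"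
    using p' D assms(1,2)
    by (cases "x \<le> y"; cases "y \<le> z"; cases "x \<le> z")
      (auto simp: opening_shift_def order_type_def add_divide_distrib intro!: centresI)
  show "order_type (opening_shift \<theta> \<phi> (order_type p) + p) = order_type p"
    using p' D assms(1,2)
    by (cases "x \<le> y"; cases "y \<le> z"; cases "x \<le> z")
      (auto simp: opening_shift_def order_type_def add_divide_distrib)
qed

lemma cnj_borel_measurable [measurable]: "cnj \<in> borel_measurable borel"
  by (intro borel_measurable_continuous_onI continuous_intros)

lemma separated_measurable [measurable (raw)]:
  assumes [measurable]: "\<theta> \<in> borel_measurable M" "\<phi> \<in> borel_measurable M"
    "x \<in> borel_measurable M" "y \<in> borel_measurable M" "z \<in> borel_measurable M"
  shows "Measurable.pred M (\<lambda>\<omega>. separated (\<theta> \<omega>) (\<phi> \<omega>) (x \<omega>) (y \<omega>) (z \<omega>))"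
  unfolding separated_def by measurable

lemma centres_measurable [measurable]: "centres \<theta> \<phi> \<in> sets borel"
proof -
  have "Measurable.pred (borel \<Otimes>\<^sub>M borel \<Otimes>\<^sub>M borel) (\<lambda>p.
    fst p \<in> {0..2 * pi} \<and> fst (snd p) \<in> {0..2 * pi} \<and> snd (snd p) \<in> {0..2 * pi} \<and>
    separated \<theta> \<phi> (cis (fst p)) (cis (fst (snd p))) (cis (snd (snd p))))"
    by measurable
  then show ?thesis
    by (simp add: centres_def case_prod_unfold pred_def space_pair_measure borel_prod del: atLeastAtMost_iff)
qed

lemma emeasure_lborel_translate:
  fixes s :: "'a::euclidean_space"
  assumes "B \<in> sets borel"
  shows "emeasure lborel {p. s + p \<in> B} = emeasure lborel B"
proof -
  have "emeasure lborel B = emeasure (distr lborel borel ((+) s)) B" by (simp only: lborel_distr_plus)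
  also have "\<dots> = emeasure lborel {p. s + p \<in> B}"
    using assms by (subst emeasure_distr) (auto simp: vimage_def)
  finally show ?thesis by simp
qed

lemma emeasure_lborel_Times:
  fixes A :: "'a::euclidean_space set" and B :: "'b::euclidean_space set"
  assumes "A \<in> sets borel" "B \<in> sets borel"
  shows "emeasure lborel (A \<times> B) = emeasure lborel A * emeasure lborel B"
  unfolding lborel_prod[symmetric] using assms by (intro lborel.emeasure_pair_measure_Times) auto

lemma emeasure_cube:
  assumes "0 \<le> D"
  shows "emeasure lborel ({0<..<D::real} \<times> {0<..<D} \<times> {0<..<D}) = ennreal (D ^ 3)"
proof -
  have "{0<..<D} \<times> {0<..<D} \<in> sets borel" by (simp add: borel_open open_Times)
  then show ?thesis using assms
    by (simp add: emeasure_lborel_Times power3_eq_cube ennreal_mult' mult.assoc)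
qed

text \<open>Opening the arcs maps the cube of side \<open>D\<close> into the separated configurations. The map is a
  translation on each order type and preserves the order type, and preserves the order type, so its image has the volume of the cube. This avoids
  the volumes of simplices: the pieces of the cube never have to be computed one by one.\<close>

lemma emeasure_centres_ge:
  assumes "0 \<le> \<theta>" "0 \<le> \<phi>" "\<theta> + \<phi> \<le> pi"
  shows "ennreal ((2 * pi - 2 * \<theta> - 2 * \<phi>) ^ 3) \<le> emeasure lborel (centres \<theta> \<phi>)"
proof -
  define D where "D = 2 * pi - 2 * \<theta> - 2 * \<phi>"
  define Q where "Q = {0<..<D} \<times> {0<..<D} \<times> {0<..<D}"
  have "0 \<le> D" using assms by (simp add: D_def)
  have Q: "Q \<in> sets borel" unfolding Q_def borel_prod[symmetric] by measurable
  define T where "T i = {p. order_type p = i}" for i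
  have T: "T i \<in> sets borel" for i
  proof -
    obtain a b c where i: "i = (a, b, c)" by (cases i)
    have "T i = {p. (fst p \<le> fst (snd p)) = a \<and> (fst (snd p) \<le> snd (snd p)) = b \<and> (fst p \<le> snd (snd p)) = c}"
      by (auto simp: T_def i order_type_def)
    also have "\<dots> \<in> sets borel"
    proof -
      have "Measurable.pred (borel \<Otimes>\<^sub>M borel \<Otimes>\<^sub>M borel) (\<lambda>p::real \<times> real \<times> real.
        (fst p \<le> fst (snd p)) = a \<and> (fst (snd p) \<le> snd (snd p)) = b \<and> (fst p \<le> snd (snd p)) = c)"
        by (cases a; cases b; cases c; simp; measurable)
      then show ?thesis by (simp add: pred_def space_pair_measure borel_prod)
    qed
    finally show ?thesis .
  qed
  have "ennreal (D ^ 3) = emeasure lborel Q" using \<open>0 \<le> D\<close> by (simp add: Q_def emeasure_cube)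
  also have "Q = (\<Union>i\<in>UNIV. Q \<inter> T i)" by (auto simp: T_def)
  also have "emeasure lborel \<dots> = (\<Sum>i\<in>UNIV. emeasure lborel (Q \<inter> T i))"
    using Q T by (intro sum_emeasure[symmetric]) (auto simp: disjoint_family_on_def T_def)
  also have "\<dots> \<le> (\<Sum>i\<in>UNIV. emeasure lborel (centres \<theta> \<phi> \<inter> T i))"
  proof (rule sum_mono)
    fix i
    have B: "centres \<theta> \<phi> \<inter> T i \<in> sets borel" using T centres_measurable by blast
    have "Q \<inter> T i \<subseteq> {p. opening_shift \<theta> \<phi> i + p \<in> centres \<theta> \<phi> \<inter> T i}"
      using opening_shift_separates[OF assms(1,2) _ D_def] by (auto simp: Q_def T_def)
    moreover have "{p. opening_shift \<theta> \<phi> i + p \<in> centres \<theta> \<phi> \<inter> T i} \<in> sets borel"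
      using B by measurable
    ultimately have "emeasure lborel (Q \<inter> T i) \<le> emeasure lborel {p. opening_shift \<theta> \<phi> i + p \<in> centres \<theta> \<phi> \<inter> T i}"
      by (intro emeasure_mono) auto
    then show "emeasure lborel (Q \<inter> T i) \<le> emeasure lborel (centres \<theta> \<phi> \<inter> T i)"
      by (simp only: emeasure_lborel_translate[OF B])
  qed
  also have "\<dots> = emeasure lborel (\<Union>i\<in>UNIV. centres \<theta> \<phi> \<inter> T i)"
    using T by (intro sum_emeasure) (auto simp: disjoint_family_on_def T_def)
  also have "(\<Union>i\<in>UNIV. centres \<theta> \<phi> \<inter> T i) = centres \<theta> \<phi>" by (auto simp: T_def)
  finally show ?thesis by (simp add: D_def)
qed

section \<open>Averaging over the circle\<close>

text \<open>Half-open intervals of angles fit together without overlap when a period is cut; the version that is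
  open on the left becomes the other one under \<open>t \<mapsto> - t\<close>.\<close>

lemma nn_integral_uniform_circle:
  assumes [measurable]: "h \<in> borel_measurable borel"
  shows "(\<integral>\<^sup>+z. h z \<partial>uniform_circle)
    = (\<integral>\<^sup>+t. h (cis t) * indicator {0..<2 * pi} t \<partial>lborel) / ennreal (2 * pi)"
    and "(\<integral>\<^sup>+z. h z \<partial>uniform_circle)
    = (\<integral>\<^sup>+t. h (cis t) * indicator {0<..2 * pi} t \<partial>lborel) / ennreal (2 * pi)"
    and "(\<integral>\<^sup>+z. h z \<partial>uniform_circle)
    = (\<integral>\<^sup>+t. h (cis t) * indicator {0..2 * pi} t \<partial>lborel) / ennreal (2 * pi)"
proof -
  show 1: "(\<integral>\<^sup>+z. h z \<partial>uniform_circle)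
    = (\<integral>\<^sup>+t. h (cis t) * indicator {0..2 * pi} t \<partial>lborel) / ennreal (2 * pi)"
    unfolding uniform_circle_def
    by (subst nn_integral_distr) (simp_all add: nn_integral_uniform_measure)
  have "AE t in lborel. t \<noteq> 0 \<and> t \<noteq> 2 * pi"
    using AE_lborel_singleton[of 0] AE_lborel_singleton[of "2 * pi"] by eventually_elim simp
  then have "AE t in lborel. (indicator {0..2 * pi} t :: ennreal) = indicator {0..<2 * pi} t"
    "AE t in lborel. (indicator {0..2 * pi} t :: ennreal) = indicator {0<..2 * pi} t"
    by (rule eventually_mono; auto simp: indicator_def)+
  then have "(\<integral>\<^sup>+t. h (cis t) * indicator {0..2 * pi} t \<partial>lborel)
      = (\<integral>\<^sup>+t. h (cis t) * indicator {0..<2 * pi} t \<partial>lborel)"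
    "(\<integral>\<^sup>+t. h (cis t) * indicator {0..2 * pi} t \<partial>lborel)
      = (\<integral>\<^sup>+t. h (cis t) * indicator {0<..2 * pi} t \<partial>lborel)"
    by (auto intro!: nn_integral_cong_AE elim: eventually_mono)
  with 1 show "(\<integral>\<^sup>+z. h z \<partial>uniform_circle)
    = (\<integral>\<^sup>+t. h (cis t) * indicator {0..<2 * pi} t \<partial>lborel) / ennreal (2 * pi)"
    "(\<integral>\<^sup>+z. h z \<partial>uniform_circle)
    = (\<integral>\<^sup>+t. h (cis t) * indicator {0<..2 * pi} t \<partial>lborel) / ennreal (2 * pi)"
    by simp_all
qed

lemma nn_integral_arc_shift:
  assumes [measurable]: "h \<in> borel_measurable borel"
  shows "(\<integral>\<^sup>+t. h (cis t) * indicator {a + s..<b + s} t \<partial>lborel)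
      = (\<integral>\<^sup>+t. h (cis (s + t)) * indicator {a..<b} t \<partial>lborel)"
proof -
  have "(\<integral>\<^sup>+t. h (cis t) * indicator {a + s..<b + s} t \<partial>lborel)
      = (\<integral>\<^sup>+t. h (cis (s + 1 * t)) * indicator {a + s..<b + s} (s + 1 * t) \<partial>lborel)"
    by (subst nn_integral_real_affine[of _ 1 s]) simp_all
  also have "\<dots> = (\<integral>\<^sup>+t. h (cis (s + t)) * indicator {a..<b} t \<partial>lborel)"
    by (intro nn_integral_cong) (simp add: indicator_def)
  finally show ?thesis .
qed

lemma nn_integral_uniform_circle_rotate:
  assumes [measurable]: "h \<in> borel_measurable borel" and k: "cmod k = 1"
  shows "(\<integral>\<^sup>+z. h (k * z) \<partial>uniform_circle) = (\<integral>\<^sup>+z. h z \<partial>uniform_circle)"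
proof -
  obtain s where s: "0 \<le> s" "s < 2 * pi" and "k = Complex (cos s) (sin s)"
    using complex_unimodular_polar[OF k] .
  then have ks: "k = cis s" by (simp add: complex_eq_iff)
  have "(\<integral>\<^sup>+t. h (k * cis t) * indicator {0..<2 * pi} t \<partial>lborel)
      = (\<integral>\<^sup>+t. h (cis t) * indicator {0 + s..<2 * pi + s} t \<partial>lborel)"
    by (subst nn_integral_arc_shift) (simp_all add: ks cis_mult)
  \<comment> \<open>The part of the shifted interval beyond the period is moved back to its beginning.\<close>
  also have "\<dots> = (\<integral>\<^sup>+t. h (cis t) * indicator {s..<2 * pi} t
      + h (cis t) * indicator {0 + 2 * pi..<s + 2 * pi} t \<partial>lborel)"
    using s by (intro nn_integral_cong) (auto simp: indicator_def)
  also have "\<dots> = (\<integral>\<^sup>+t. h (cis t) * indicator {s..<2 * pi} t \<partial>lborel)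
      + (\<integral>\<^sup>+t. h (cis t) * indicator {0 + 2 * pi..<s + 2 * pi} t \<partial>lborel)"
    by (intro nn_integral_add) measurable
  also have "(\<integral>\<^sup>+t. h (cis t) * indicator {0 + 2 * pi..<s + 2 * pi} t \<partial>lborel)
      = (\<integral>\<^sup>+t. h (cis t) * indicator {0..<s} t \<partial>lborel)"
    by (subst nn_integral_arc_shift) (simp_all add: cis_mult[symmetric])
  also have "(\<integral>\<^sup>+t. h (cis t) * indicator {s..<2 * pi} t \<partial>lborel) + \<dots>
      = (\<integral>\<^sup>+t. h (cis t) * indicator {s..<2 * pi} t + h (cis t) * indicator {0..<s} t \<partial>lborel)"
    by (intro nn_integral_add[symmetric]) measurable
  also have "\<dots> = (\<integral>\<^sup>+t. h (cis t) * indicator {0..<2 * pi} t \<partial>lborel)"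
    using s by (intro nn_integral_cong) (auto simp: indicator_def)
  finally show ?thesis by (simp add: nn_integral_uniform_circle(1))
qed

text \<open>Taking the inverse square is a surjective endomorphism of the circle group, hence preserves Haar
  measure; concretely, it winds twice around the circle in the negative direction.\<close>

lemma nn_integral_uniform_circle_inverse_square:
  assumes [measurable]: "h \<in> borel_measurable borel" and k: "cmod k = 1"
  shows "(\<integral>\<^sup>+z. h (k / z\<^sup>2) \<partial>uniform_circle) = (\<integral>\<^sup>+z. h z \<partial>uniform_circle)"
proof -
  define g where "g z = h (k * z)" for z
  have [measurable]: "g \<in> borel_measurable borel" unfolding g_def by measurable
  let ?J = "\<integral>\<^sup>+t. g (cis t) * indicator {0..<2 * pi} t \<partial>lborel"
  let ?I = "\<integral>\<^sup>+t. g (1 / (cis t)\<^sup>2) * indicator {0<..2 * pi} t \<partial>lborel"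
  have c: "1 / (cis t)\<^sup>2 = cis (-2 * t)" for t
    by (simp add: cis_divide[symmetric] Complex.DeMoivre power2_eq_square flip: cis_inverse)
       (simp add: cis_mult cis_inverse divide_inverse)
  have "ennreal 2 * ?I = (\<integral>\<^sup>+t. g (cis t) * indicator {- 4 * pi..<0} t \<partial>lborel)"
  proof -
    have "(\<integral>\<^sup>+t. g (cis t) * indicator {- 4 * pi..<0} t \<partial>lborel)
      = ennreal 2 * (\<integral>\<^sup>+t. g (cis (-2 * t)) * indicator {- 4 * pi..<0} (-2 * t) \<partial>lborel)"
      by (subst nn_integral_real_affine[of _ "-2" 0]) simp_all
    also have "(\<integral>\<^sup>+t. g (cis (-2 * t)) * indicator {- 4 * pi..<0} (-2 * t) \<partial>lborel) = ?I"
      unfolding c by (intro nn_integral_cong) (auto simp: indicator_def)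
    finally show ?thesis by simp
  qed
  also have "\<dots> = (\<integral>\<^sup>+t. g (cis t) * indicator {0 + (- 4 * pi)..<2 * pi + (- 4 * pi)} t
      + g (cis t) * indicator {0 + (- 2 * pi)..<2 * pi + (- 2 * pi)} t \<partial>lborel)"
    by (intro nn_integral_cong) (auto simp: indicator_def)
  also have "\<dots> = (\<integral>\<^sup>+t. g (cis t) * indicator {0 + (- 4 * pi)..<2 * pi + (- 4 * pi)} t \<partial>lborel)
      + (\<integral>\<^sup>+t. g (cis t) * indicator {0 + (- 2 * pi)..<2 * pi + (- 2 * pi)} t \<partial>lborel)"
    by (intro nn_integral_add) measurable
  also have "\<dots> = ?J + ?J"
  proof -
    have "cis (- 4 * pi + t) = cis t" "cis (- 2 * pi + t) = cis t" for t
      using cis_multiple_2pi[of "-2"] cis_multiple_2pi[of "-1"]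
      unfolding cis_mult[symmetric] by (simp_all add: mult.commute mult.left_commute)
    then show ?thesis by (subst (1 2) nn_integral_arc_shift) simp_all
  qed
  also have "\<dots> = ennreal 2 * ?J" by (simp add: mult_2[symmetric])
  finally have "?I = ?J" by (simp add: ennreal_mult_cancel_left)
  then have "(\<integral>\<^sup>+z. g (1 / z\<^sup>2) \<partial>uniform_circle) = (\<integral>\<^sup>+z. g z \<partial>uniform_circle)"
    by (simp add: nn_integral_uniform_circle(1)[of g] nn_integral_uniform_circle(2)[of "\<lambda>z. g (1 / z\<^sup>2)"])
  also have "\<dots> = (\<integral>\<^sup>+z. h z \<partial>uniform_circle)"
    unfolding g_def by (rule nn_integral_uniform_circle_rotate) (use k in auto)
  finally show ?thesis by (simp add: g_def)
qed

lemma nn_integral_const_power_segment: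
  assumes "0 \<le> c" "c \<le> 1"
  shows "(\<integral>\<^sup>+t. ennreal ((c - t / pi) ^ n) * indicator {0..pi * c} t \<partial>lborel)
    = ennreal (pi * c ^ Suc n / Suc n)"
proof -
  let ?F = "\<lambda>t. - (pi / Suc n) * (c - t / pi) ^ Suc n"
  have "(\<integral>\<^sup>+t. ennreal ((c - t / pi) ^ n) * indicator {0..pi * c} t \<partial>lborel)
    = ennreal (?F (pi * c) - ?F 0)"
  proof (rule nn_integral_FTC_Icc)
    fix t assume "t \<in> {0..pi * c}"
    then show "0 \<le> (c - t / pi) ^ n" by (simp add: field_simps)
    show "(?F has_real_derivative (c - t / pi) ^ n) (at t)"
      by (rule derivative_eq_intros refl | simp)+
  qed (use assms in auto)
  then show ?thesis by simp
qed

text \<open>With \<open>X = \<theta> / \<pi>\<close> and \<open>Y = \<phi> / \<pi>\<close> uniform on the unit interval, integrating the cube of the positive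
  part of \<open>1 - X - Y\<close> over \<open>Y\<close> gives \<open>(1 - X) ^ 4 / 4\<close>, and over \<open>X\<close> then \<open>1 / 20\<close>.\<close>

lemma integral_arc_lengths:
  "(\<integral>\<^sup>+\<theta>. (\<integral>\<^sup>+\<phi>. ennreal ((1 - (\<theta> + \<phi>) / pi) ^ 3) * indicator {..pi} (\<theta> + \<phi>)
      \<partial>uniform_measure lborel {0..pi}) \<partial>uniform_measure lborel {0..pi}) = ennreal (1 / 20)"
proof -
  have inner: "(\<integral>\<^sup>+\<phi>. ennreal ((1 - (\<theta> + \<phi>) / pi) ^ 3) * indicator {..pi} (\<theta> + \<phi>)
      \<partial>uniform_measure lborel {0..pi}) = ennreal ((1 - \<theta> / pi) ^ 4 / 4)"
    if \<theta>: "\<theta> \<in> {0..pi}" for \<theta>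
  proof -
    let ?c = "1 - \<theta> / pi"
    have c: "0 \<le> ?c" "?c \<le> 1" using \<theta> by (auto simp: field_simps)
    have "(\<integral>\<^sup>+\<phi>. ennreal ((1 - (\<theta> + \<phi>) / pi) ^ 3) * indicator {..pi} (\<theta> + \<phi>)
        \<partial>uniform_measure lborel {0..pi})
      = (\<integral>\<^sup>+\<phi>. ennreal ((1 - (\<theta> + \<phi>) / pi) ^ 3) * indicator {..pi} (\<theta> + \<phi>) * indicator {0..pi} \<phi> \<partial>lborel) / ennreal pi"
      by (subst nn_integral_uniform_measure) auto
    also have "(\<integral>\<^sup>+\<phi>. ennreal ((1 - (\<theta> + \<phi>) / pi) ^ 3) * indicator {..pi} (\<theta> + \<phi>) * indicator {0..pi} \<phi> \<partial>lborel)
      = (\<integral>\<^sup>+\<phi>. ennreal ((?c - \<phi> / pi) ^ 3) * indicator {0..pi * ?c} \<phi> \<partial>lborel)"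
    proof (intro nn_integral_cong)
      fix \<phi> :: real
      have "1 - (\<theta> + \<phi>) / pi = ?c - \<phi> / pi" "pi * ?c = pi - \<theta>" by (simp_all add: field_simps)
      then show "ennreal ((1 - (\<theta> + \<phi>) / pi) ^ 3) * indicator {..pi} (\<theta> + \<phi>) * indicator {0..pi} \<phi>
          = ennreal ((?c - \<phi> / pi) ^ 3) * indicator {0..pi * ?c} \<phi>"
        using \<theta> by (simp only:) (auto simp: indicator_def)
    qed
    also have "\<dots> = ennreal (pi * ?c ^ 4 / 4)"
      using nn_integral_const_power_segment[OF c, of 3] by simp
    also have "\<dots> / ennreal pi = ennreal (?c ^ 4 / 4)"
      using c by (simp add: divide_ennreal)
    finally show ?thesis .
  qed
  let ?T = "uniform_measure lborel {0..pi}"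
  have "(\<integral>\<^sup>+\<theta>. (\<integral>\<^sup>+\<phi>. ennreal ((1 - (\<theta> + \<phi>) / pi) ^ 3) * indicator {..pi} (\<theta> + \<phi>) \<partial>?T) \<partial>?T)
     = (\<integral>\<^sup>+\<theta>. ennreal (1 / 4) * ennreal ((1 - \<theta> / pi) ^ 4) \<partial>?T)"
  proof (intro nn_integral_cong_AE AE_uniform_measureI AE_I2 impI)
    fix \<theta> assume "\<theta> \<in> {0..pi}"
    then show "(\<integral>\<^sup>+\<phi>. ennreal ((1 - (\<theta> + \<phi>) / pi) ^ 3) * indicator {..pi} (\<theta> + \<phi>) \<partial>?T)
      = ennreal (1 / 4) * ennreal ((1 - \<theta> / pi) ^ 4)"
      by (simp only: inner) (simp add: ennreal_mult[symmetric])
  qed simp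
  also have "\<dots> = ennreal (1 / 4) * ((\<integral>\<^sup>+\<theta>. ennreal ((1 - \<theta> / pi) ^ 4) * indicator {0..pi * 1} \<theta> \<partial>lborel) / ennreal pi)"
    by (subst nn_integral_cmult) (simp_all add: nn_integral_uniform_measure)
  also have "\<dots> = ennreal (1 / 4) * (ennreal (pi * 1 ^ Suc 4 / Suc 4) / ennreal pi)"
    by (subst nn_integral_const_power_segment) simp_all
  also have "\<dots> = ennreal (1 / 20)"
    by (simp add: divide_ennreal ennreal_mult[symmetric])
  finally show ?thesis .
qed

section \<open>The probability that the four arcs have disjoint interiors\<close>

abbreviation arc_law :: "real measure" where
  "arc_law \<equiv> uniform_measure lborel {0..pi}"

abbreviation element_law :: "(complex \<times> complex \<times> real) measure" where
  "element_law \<equiv> uniform_circle \<Otimes>\<^sub>M uniform_circle \<Otimes>\<^sub>M arc_law"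

lemma nn_integral_uniform_circle_weight:
  assumes [measurable]: "h \<in> borel_measurable borel"
  shows "(\<integral>\<^sup>+z. h z \<partial>uniform_circle)
    = (\<integral>\<^sup>+t. h (cis t) * (indicator {0..2 * pi} t * ennreal (1 / (2 * pi))) \<partial>lborel)"
proof -
  have "(\<integral>\<^sup>+t. h (cis t) * (indicator {0..2 * pi} t * ennreal (1 / (2 * pi))) \<partial>lborel)
      = (\<integral>\<^sup>+t. h (cis t) * indicator {0..2 * pi} t \<partial>lborel) * ennreal (1 / (2 * pi))"
    unfolding mult.assoc[symmetric] by (rule nn_integral_multc) measurable
  then show ?thesis
    unfolding nn_integral_uniform_circle(3)[OF assms] divide_ennreal_def
    by (simp add: inverse_ennreal inverse_eq_divide)
qed

definition separated_ind :: "real \<Rightarrow> real \<Rightarrow> complex \<Rightarrow> complex \<Rightarrow> complex \<Rightarrow> ennreal" where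
  "separated_ind \<theta> \<phi> x y z = (if separated \<theta> \<phi> x y z then 1 else 0)"

lemma separated_ind_measurable [measurable (raw)]:
  assumes [measurable]: "\<theta> \<in> borel_measurable M" "\<phi> \<in> borel_measurable M"
    "x \<in> borel_measurable M" "y \<in> borel_measurable M" "z \<in> borel_measurable M"
  shows "(\<lambda>\<omega>. separated_ind (\<theta> \<omega>) (\<phi> \<omega>) (x \<omega>) (y \<omega>) (z \<omega>)) \<in> borel_measurable M"
  unfolding separated_ind_def by measurable

interpretation circle: prob_space uniform_circle
  by (rule prob_uniform_circle)

interpretation arc: prob_space arc_law
  by (rule prob_uniform_angle) simp

lemma nn_integral_lborel_triple:
  fixes f :: "real \<times> real \<times> real \<Rightarrow> ennreal"
  assumes [measurable]: "f \<in> borel_measurable borel"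
  shows "(\<integral>\<^sup>+p. f p \<partial>lborel) = (\<integral>\<^sup>+x. (\<integral>\<^sup>+y. (\<integral>\<^sup>+z. f (x, y, z) \<partial>lborel) \<partial>lborel) \<partial>lborel)"
proof -
  have f: "f \<in> borel_measurable (lborel \<Otimes>\<^sub>M lborel)" "\<And>x. (\<lambda>q. f (x, q)) \<in> borel_measurable (lborel \<Otimes>\<^sub>M lborel)"
    by (simp_all add: lborel_prod)
  have "(\<integral>\<^sup>+p. f p \<partial>lborel) = (\<integral>\<^sup>+x. (\<integral>\<^sup>+q. f (x, q) \<partial>lborel) \<partial>lborel)"
    unfolding lborel.nn_integral_fst[OF f(1)] by (simp add: lborel_prod)
  also have "\<dots> = (\<integral>\<^sup>+x. (\<integral>\<^sup>+y. (\<integral>\<^sup>+z. f (x, y, z) \<partial>lborel) \<partial>lborel) \<partial>lborel)"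
    unfolding lborel.nn_integral_fst[OF f(2)] by (simp add: lborel_prod)
  finally show ?thesis .
qed

text \<open>The volume bound divided by the volume \<open>(2 \<pi>) ^ 3\<close> of all positions of three midpoints relative to
  the first one.\<close>

lemma separated_probability_ge:
  assumes "0 \<le> \<theta>" "0 \<le> \<phi>"
  shows "ennreal ((1 - (\<theta> + \<phi>) / pi) ^ 3) * indicator {..pi} (\<theta> + \<phi>)
    \<le> (\<integral>\<^sup>+x. (\<integral>\<^sup>+y. (\<integral>\<^sup>+z. separated_ind \<theta> \<phi> x y z \<partial>uniform_circle) \<partial>uniform_circle) \<partial>uniform_circle)"
proof (cases "\<theta> + \<phi> \<le> pi")
  case True
  define r where "r = 1 / (2 * pi)"
  define w :: "real \<Rightarrow> ennreal" where "w t = indicator {0..2 * pi} t * ennreal r" for t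
  have [measurable]: "w \<in> borel_measurable borel" unfolding w_def by measurable
  have circ: "(\<integral>\<^sup>+z. h z \<partial>uniform_circle) = (\<integral>\<^sup>+t. h (cis t) * w t \<partial>lborel)"
    if "h \<in> borel_measurable borel" for h
    unfolding w_def r_def by (rule nn_integral_uniform_circle_weight[OF that])
  let ?G = "separated_ind \<theta> \<phi>"
  have "(\<integral>\<^sup>+x. (\<integral>\<^sup>+y. (\<integral>\<^sup>+z. ?G x y z \<partial>uniform_circle) \<partial>uniform_circle) \<partial>uniform_circle)
    = (\<integral>\<^sup>+x. (\<integral>\<^sup>+y. (\<integral>\<^sup>+z. ?G (cis x) (cis y) (cis z) * w z \<partial>lborel) * w y \<partial>lborel) * w x \<partial>lborel)"
  proof -
    have 1: "(\<integral>\<^sup>+x. (\<integral>\<^sup>+y. (\<integral>\<^sup>+z. ?G x y z \<partial>uniform_circle) \<partial>uniform_circle) \<partial>uniform_circle)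
      = (\<integral>\<^sup>+x. (\<integral>\<^sup>+y. (\<integral>\<^sup>+z. ?G (cis x) y z \<partial>uniform_circle) \<partial>uniform_circle) * w x \<partial>lborel)"
      by (rule circ) measurable
    have 2: "(\<integral>\<^sup>+y. (\<integral>\<^sup>+z. ?G u y z \<partial>uniform_circle) \<partial>uniform_circle)
      = (\<integral>\<^sup>+y. (\<integral>\<^sup>+z. ?G u (cis y) z \<partial>uniform_circle) * w y \<partial>lborel)" for u
      by (rule circ) measurable
    have 3: "(\<integral>\<^sup>+z. ?G u v z \<partial>uniform_circle) = (\<integral>\<^sup>+z. ?G u v (cis z) * w z \<partial>lborel)" for u v
      by (rule circ) measurable
    show ?thesis unfolding 1 unfolding 2 unfolding 3 ..
  qed
  also have "\<dots> = (\<integral>\<^sup>+x. (\<integral>\<^sup>+y. (\<integral>\<^sup>+z. ?G (cis x) (cis y) (cis z) * w z * w y * w x \<partial>lborel) \<partial>lborel) \<partial>lborel)"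
  proof (rule nn_integral_cong)
    fix x
    have "(\<integral>\<^sup>+y. (\<integral>\<^sup>+z. ?G (cis x) (cis y) (cis z) * w z \<partial>lborel) * w y \<partial>lborel) * w x
      = (\<integral>\<^sup>+y. (\<integral>\<^sup>+z. ?G (cis x) (cis y) (cis z) * w z \<partial>lborel) * w y * w x \<partial>lborel)"
      by (rule nn_integral_multc[symmetric]) measurable
    also have "\<dots> = (\<integral>\<^sup>+y. (\<integral>\<^sup>+z. ?G (cis x) (cis y) (cis z) * w z * w y * w x \<partial>lborel) \<partial>lborel)"
    proof (rule nn_integral_cong)
      fix y
      have "(\<integral>\<^sup>+z. ?G (cis x) (cis y) (cis z) * w z \<partial>lborel) * (w y * w x)
        = (\<integral>\<^sup>+z. ?G (cis x) (cis y) (cis z) * w z * (w y * w x) \<partial>lborel)"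
        by (rule nn_integral_multc[symmetric]) measurable
      then show "(\<integral>\<^sup>+z. ?G (cis x) (cis y) (cis z) * w z \<partial>lborel) * w y * w x
        = (\<integral>\<^sup>+z. ?G (cis x) (cis y) (cis z) * w z * w y * w x \<partial>lborel)"
        by (simp only: mult.assoc)
    qed
    finally show "(\<integral>\<^sup>+y. (\<integral>\<^sup>+z. ?G (cis x) (cis y) (cis z) * w z \<partial>lborel) * w y \<partial>lborel) * w x
      = (\<integral>\<^sup>+y. (\<integral>\<^sup>+z. ?G (cis x) (cis y) (cis z) * w z * w y * w x \<partial>lborel) \<partial>lborel)" .
  qed
  also have "\<dots> = (\<integral>\<^sup>+x. (\<integral>\<^sup>+y. (\<integral>\<^sup>+z. indicator (centres \<theta> \<phi>) (x, y, z) * ennreal (r ^ 3) \<partial>lborel) \<partial>lborel) \<partial>lborel)"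
  proof (intro nn_integral_cong)
    fix x y z
    have "0 \<le> r" by (simp add: r_def)
    then have "ennreal r * (ennreal r * ennreal r) = ennreal (r ^ 3)"
      by (simp add: power3_eq_cube ennreal_mult' mult.assoc)
    then show "?G (cis x) (cis y) (cis z) * w z * w y * w x = indicator (centres \<theta> \<phi>) (x, y, z) * ennreal (r ^ 3)"
      unfolding separated_ind_def w_def centres_def indicator_def by (simp add: mult.assoc)
  qed
  also have "\<dots> = (\<integral>\<^sup>+p. indicator (centres \<theta> \<phi>) p * ennreal (r ^ 3) \<partial>lborel)"
    by (rule nn_integral_lborel_triple[symmetric]) measurable
  also have "\<dots> = emeasure lborel (centres \<theta> \<phi>) * ennreal (r ^ 3)"
    by (subst nn_integral_multc) simp_all
  also have "\<dots> \<ge> ennreal ((2 * pi - 2 * \<theta> - 2 * \<phi>) ^ 3) * ennreal (r ^ 3)"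
    by (intro mult_right_mono emeasure_centres_ge assms True) simp
  also have "ennreal ((2 * pi - 2 * \<theta> - 2 * \<phi>) ^ 3) * ennreal (r ^ 3) = ennreal ((1 - (\<theta> + \<phi>) / pi) ^ 3)"
  proof -
    have "(2 * pi - 2 * \<theta> - 2 * \<phi>) * r = 1 - (\<theta> + \<phi>) / pi" by (simp add: r_def field_simps)
    then have "(2 * pi - 2 * \<theta> - 2 * \<phi>) ^ 3 * r ^ 3 = (1 - (\<theta> + \<phi>) / pi) ^ 3"
      by (simp only: power_mult_distrib[symmetric])
    then show ?thesis using True by (simp add: ennreal_mult[symmetric] r_def)
  qed
  finally show ?thesis using True by simp
qed simp

text \<open>With \<open>u = a / \<bar>a\<bar>\<close> and \<open>v = c / \<bar>c\<bar>\<close>, the isometric disks of the inverse and of the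
  transformation itself have their centres in the directions \<open>u * v\<close> and \<open>- v / u\<close>. The three
  arguments of \<open>separated\<close> are the quotients of the last three of the four directions by the first one.
  Requiring all vectors to be unit vectors excludes \<open>c = 0\<close>, where \<open>c / \<bar>c\<bar>\<close> is \<open>0\<close>.\<close>

definition separated_pair :: "complex \<times> complex \<times> real \<Rightarrow> complex \<times> complex \<times> real \<Rightarrow> bool" where
  "separated_pair p q = (case p of (u, v, \<theta>) \<Rightarrow> case q of (u', v', \<phi>) \<Rightarrow>
     cmod u = 1 \<and> cmod v = 1 \<and> cmod u' = 1 \<and> cmod v' = 1 \<and>
     separated \<theta> \<phi> (- 1 / u\<^sup>2) (u' * v' / (u * v)) (- v' / (u' * u * v)))"

lemma separated_pair_measurable [measurable]:
  "Measurable.pred (element_law \<Otimes>\<^sub>M element_law) (\<lambda>(p, q). separated_pair p q)"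
  unfolding separated_pair_def case_prod_unfold by measurable

lemma nn_integral_swap:
  assumes "prob_space A" "prob_space B" "case_prod f \<in> borel_measurable (A \<Otimes>\<^sub>M B)"
  shows "(\<integral>\<^sup>+x. (\<integral>\<^sup>+y. f x y \<partial>B) \<partial>A) = (\<integral>\<^sup>+y. (\<integral>\<^sup>+x. f x y \<partial>A) \<partial>B)"
proof -
  interpret pair_sigma_finite A B
    by (intro pair_sigma_finite.intro prob_space_imp_sigma_finite assms)
  show ?thesis using Fubini'[OF assms(3)] by simp
qed

lemma nn_integral_element_law:
  assumes [measurable]: "f \<in> borel_measurable element_law"
  shows "(\<integral>\<^sup>+p. f p \<partial>element_law)
    = (\<integral>\<^sup>+u. (\<integral>\<^sup>+v. (\<integral>\<^sup>+\<theta>. f (u, v, \<theta>) \<partial>arc_law) \<partial>uniform_circle) \<partial>uniform_circle)"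
proof -
  interpret CT: prob_space "uniform_circle \<Otimes>\<^sub>M arc_law"
    by (intro prob_space_pair prob_uniform_circle arc.prob_space_axioms)
  have "(\<integral>\<^sup>+p. f p \<partial>element_law) = (\<integral>\<^sup>+u. (\<integral>\<^sup>+q. f (u, q) \<partial>(uniform_circle \<Otimes>\<^sub>M arc_law)) \<partial>uniform_circle)"
    by (rule CT.nn_integral_fst[symmetric]) measurable
  also have "\<dots> = (\<integral>\<^sup>+u. (\<integral>\<^sup>+v. (\<integral>\<^sup>+\<theta>. f (u, v, \<theta>) \<partial>arc_law) \<partial>uniform_circle) \<partial>uniform_circle)"
  proof (rule nn_integral_cong)
    fix u assume "u \<in> space uniform_circle"
    then have "(\<lambda>q. f (u, q)) \<in> borel_measurable (uniform_circle \<Otimes>\<^sub>M arc_law)" by measurable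
    from arc.nn_integral_fst[OF this]
    show "(\<integral>\<^sup>+q. f (u, q) \<partial>(uniform_circle \<Otimes>\<^sub>M arc_law)) = (\<integral>\<^sup>+v. (\<integral>\<^sup>+\<theta>. f (u, v, \<theta>) \<partial>arc_law) \<partial>uniform_circle)"
      by simp
  qed
  finally show ?thesis .
qed

text \<open>The last two quotients become independent and uniform: for fixed \<open>u'\<close> the first of them, \<open>y\<close>, is
  a rotation of \<open>v'\<close>, and the other one is then \<open>- y / u'\<^sup>2\<close>, which is uniform for fixed \<open>y\<close>.\<close>

lemma separated_pair_inner:
  assumes u: "cmod u = 1" and v: "cmod v = 1"
  shows "(\<integral>\<^sup>+q. (if separated_pair (u, v, \<theta>) q then 1 else 0) \<partial>element_law)
    = (\<integral>\<^sup>+y. (\<integral>\<^sup>+z. (\<integral>\<^sup>+\<phi>. separated_ind \<theta> \<phi> (- 1 / u\<^sup>2) y z \<partial>arc_law) \<partial>uniform_circle) \<partial>uniform_circle)"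
proof -
  define H where "H y z = (\<integral>\<^sup>+\<phi>. separated_ind \<theta> \<phi> (- 1 / u\<^sup>2) y z \<partial>arc_law)" for y z
  have H [measurable]: "(\<lambda>\<omega>. H (Y \<omega>) (Z \<omega>)) \<in> borel_measurable M"
    if [measurable]: "Y \<in> borel_measurable M" "Z \<in> borel_measurable M" for Y Z and M :: "'m measure"
    unfolding H_def by measurable
  have "(\<integral>\<^sup>+q. (if separated_pair (u, v, \<theta>) q then 1 else 0) \<partial>element_law)
    = (\<integral>\<^sup>+u'. (\<integral>\<^sup>+v'. (\<integral>\<^sup>+\<phi>. (if separated_pair (u, v, \<theta>) (u', v', \<phi>) then 1 else 0) \<partial>arc_law) \<partial>uniform_circle) \<partial>uniform_circle)"
    by (rule nn_integral_element_law) (unfold separated_pair_def case_prod_unfold, measurable)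
  also have "\<dots> = (\<integral>\<^sup>+u'. (\<integral>\<^sup>+y. H y (- y / u'\<^sup>2) \<partial>uniform_circle) \<partial>uniform_circle)"
  proof (rule nn_integral_cong_AE, rule eventually_mono[OF AE_uniform_circle])
    fix u' assume u': "cmod u' = 1"
    let ?k = "u' / (u * v)"
    have nz: "u \<noteq> 0" "v \<noteq> 0" "u' \<noteq> 0" using u v u' by auto
    have "(\<integral>\<^sup>+v'. (\<integral>\<^sup>+\<phi>. (if separated_pair (u, v, \<theta>) (u', v', \<phi>) then 1 else 0) \<partial>arc_law) \<partial>uniform_circle)
      = (\<integral>\<^sup>+v'. H (?k * v') (- (?k * v') / u'\<^sup>2) \<partial>uniform_circle)"
    proof (rule nn_integral_cong_AE, rule eventually_mono[OF AE_uniform_circle])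
      fix v' assume v': "cmod v' = 1"
      have eq: "- v' / (u' * u * v) = - (?k * v') / u'\<^sup>2" "u' * v' / (u * v) = ?k * v'"
        using nz by (simp_all add: field_simps power2_eq_square)
      then show "(\<integral>\<^sup>+\<phi>. (if separated_pair (u, v, \<theta>) (u', v', \<phi>) then 1 else 0) \<partial>arc_law)
          = H (?k * v') (- (?k * v') / u'\<^sup>2)"
        by (simp only: H_def separated_pair_def separated_ind_def prod.case u v u' v' eq simp_thms)
    qed
    also have "\<dots> = (\<integral>\<^sup>+y. H y (- y / u'\<^sup>2) \<partial>uniform_circle)"
      using u v u' by (intro nn_integral_uniform_circle_rotate) (simp_all add: norm_divide norm_mult)
    finally show "(\<integral>\<^sup>+v'. (\<integral>\<^sup>+\<phi>. (if separated_pair (u, v, \<theta>) (u', v', \<phi>) then 1 else 0) \<partial>arc_law) \<partial>uniform_circle)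
      = (\<integral>\<^sup>+y. H y (- y / u'\<^sup>2) \<partial>uniform_circle)" .
  qed
  also have "\<dots> = (\<integral>\<^sup>+y. (\<integral>\<^sup>+u'. H y (- y / u'\<^sup>2) \<partial>uniform_circle) \<partial>uniform_circle)"
    by (intro nn_integral_swap prob_uniform_circle) measurable
  also have "\<dots> = (\<integral>\<^sup>+y. (\<integral>\<^sup>+z. H y z \<partial>uniform_circle) \<partial>uniform_circle)"
  proof (rule nn_integral_cong_AE, rule eventually_mono[OF AE_uniform_circle])
    fix y assume "cmod y = 1"
    then show "(\<integral>\<^sup>+u'. H y (- y / u'\<^sup>2) \<partial>uniform_circle) = (\<integral>\<^sup>+z. H y z \<partial>uniform_circle)"
      by (intro nn_integral_uniform_circle_inverse_square) simp_all
  qed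
  finally show ?thesis by (simp only: H_def)
qed

text \<open>By the same reasoning the remaining quotient \<open>- 1 / u\<^sup>2\<close> is uniform, and independent of the
  other two. Once the integrals over the arc lengths are moved outside, the
  bound for fixed lengths applies.\<close>

lemma separated_pair_probability:
  "(\<integral>\<^sup>+p. (\<integral>\<^sup>+q. (if separated_pair p q then 1 else 0) \<partial>element_law) \<partial>element_law) \<ge> ennreal (1 / 20)"
proof -
  interpret E: prob_space element_law
    by (intro prob_space_pair prob_uniform_circle arc.prob_space_axioms)
  let ?C = uniform_circle
  let ?G = separated_ind
  define K where "K \<theta> x = (\<integral>\<^sup>+y. (\<integral>\<^sup>+z. (\<integral>\<^sup>+\<phi>. ?G \<theta> \<phi> x y z \<partial>arc_law) \<partial>?C) \<partial>?C)" for \<theta> x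
  have K [measurable]: "(\<lambda>\<omega>. K (Y \<omega>) (Z \<omega>)) \<in> borel_measurable M"
    if [measurable]: "Y \<in> borel_measurable M" "Z \<in> borel_measurable M" for Y Z and M :: "'m measure"
    unfolding K_def by measurable
  have "(\<integral>\<^sup>+p. (\<integral>\<^sup>+q. (if separated_pair p q then 1 else 0) \<partial>element_law) \<partial>element_law)
    = (\<integral>\<^sup>+u. (\<integral>\<^sup>+v. (\<integral>\<^sup>+\<theta>. (\<integral>\<^sup>+q. (if separated_pair (u, v, \<theta>) q then 1 else 0) \<partial>element_law) \<partial>arc_law) \<partial>?C) \<partial>?C)"
  proof (rule nn_integral_element_law)
    have "case_prod (\<lambda>p q. if separated_pair p q then 1 else 0 :: ennreal) \<in> borel_measurable (element_law \<Otimes>\<^sub>M element_law)"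
      using separated_pair_measurable unfolding case_prod_unfold by measurable
    then show "(\<lambda>p. \<integral>\<^sup>+q. (if separated_pair p q then 1 else 0) \<partial>element_law) \<in> borel_measurable element_law"
      by (rule E.borel_measurable_nn_integral)
  qed
  also have "\<dots> = (\<integral>\<^sup>+u. (\<integral>\<^sup>+v. (\<integral>\<^sup>+\<theta>. K \<theta> (- 1 / u\<^sup>2) \<partial>arc_law) \<partial>?C) \<partial>?C)"
  proof (rule nn_integral_cong_AE, rule eventually_mono[OF AE_uniform_circle],
      rule nn_integral_cong_AE, rule eventually_mono[OF AE_uniform_circle])
    fix u v assume "cmod u = 1" "cmod v = 1"
    then show "(\<integral>\<^sup>+\<theta>. (\<integral>\<^sup>+q. (if separated_pair (u, v, \<theta>) q then 1 else 0) \<partial>element_law) \<partial>arc_law)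
       = (\<integral>\<^sup>+\<theta>. K \<theta> (- 1 / u\<^sup>2) \<partial>arc_law)"
      by (simp only: separated_pair_inner K_def)
  qed
  also have "\<dots> = (\<integral>\<^sup>+u. (\<integral>\<^sup>+\<theta>. K \<theta> (- 1 / u\<^sup>2) \<partial>arc_law) \<partial>?C)"
    by (simp add: circle.emeasure_space_1)
  also have "\<dots> = (\<integral>\<^sup>+x. (\<integral>\<^sup>+\<theta>. K \<theta> x \<partial>arc_law) \<partial>?C)"
    by (intro nn_integral_uniform_circle_inverse_square[of "\<lambda>x. \<integral>\<^sup>+\<theta>. K \<theta> x \<partial>arc_law"]) simp_all
  also have "\<dots> = (\<integral>\<^sup>+\<theta>. (\<integral>\<^sup>+x. K \<theta> x \<partial>?C) \<partial>arc_law)"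
    by (intro nn_integral_swap prob_uniform_circle arc.prob_space_axioms) measurable
  also have "\<dots> = (\<integral>\<^sup>+\<theta>. (\<integral>\<^sup>+\<phi>. (\<integral>\<^sup>+x. (\<integral>\<^sup>+y. (\<integral>\<^sup>+z. ?G \<theta> \<phi> x y z \<partial>?C) \<partial>?C) \<partial>?C) \<partial>arc_law) \<partial>arc_law)"
  proof (rule nn_integral_cong)
    fix \<theta>
    have "(\<integral>\<^sup>+x. K \<theta> x \<partial>?C) = (\<integral>\<^sup>+x. (\<integral>\<^sup>+y. (\<integral>\<^sup>+\<phi>. (\<integral>\<^sup>+z. ?G \<theta> \<phi> x y z \<partial>?C) \<partial>arc_law) \<partial>?C) \<partial>?C)"
      unfolding K_def
      by (intro nn_integral_cong nn_integral_swap prob_uniform_circle arc.prob_space_axioms) measurable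
    also have "\<dots> = (\<integral>\<^sup>+x. (\<integral>\<^sup>+\<phi>. (\<integral>\<^sup>+y. (\<integral>\<^sup>+z. ?G \<theta> \<phi> x y z \<partial>?C) \<partial>?C) \<partial>arc_law) \<partial>?C)"
      by (intro nn_integral_cong nn_integral_swap prob_uniform_circle arc.prob_space_axioms) measurable
    also have "\<dots> = (\<integral>\<^sup>+\<phi>. (\<integral>\<^sup>+x. (\<integral>\<^sup>+y. (\<integral>\<^sup>+z. ?G \<theta> \<phi> x y z \<partial>?C) \<partial>?C) \<partial>?C) \<partial>arc_law)"
      by (intro nn_integral_swap prob_uniform_circle arc.prob_space_axioms) measurable
    finally show "(\<integral>\<^sup>+x. K \<theta> x \<partial>?C) = (\<integral>\<^sup>+\<phi>. (\<integral>\<^sup>+x. (\<integral>\<^sup>+y. (\<integral>\<^sup>+z. ?G \<theta> \<phi> x y z \<partial>?C) \<partial>?C) \<partial>?C) \<partial>arc_law)" .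
  qed
  also have "\<dots> \<ge> (\<integral>\<^sup>+\<theta>. (\<integral>\<^sup>+\<phi>. ennreal ((1 - (\<theta> + \<phi>) / pi) ^ 3) * indicator {..pi} (\<theta> + \<phi>) \<partial>arc_law) \<partial>arc_law)"
    by (intro nn_integral_mono_AE AE_uniform_measureI AE_I2 impI separated_probability_ge) auto
  finally show ?thesis by (simp only: integral_arc_lengths)
qed

section \<open>From separated arcs to a discrete group\<close>

lemma disjoint_disks_sym: "disjoint_disks x y \<longleftrightarrow> disjoint_disks y x"
  by (simp add: disjoint_disks_def norm_minus_commute add.commute)

text \<open>The square of the distance condition, rewritten with \<open>\<bar>a\<bar>\<^sup>2 = 1 + \<bar>c\<bar>\<^sup>2\<close>: since the disks are
  orthogonal to the unit circle, only the angle between their centres remains.\<close>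

lemma disjoint_disksI:
  assumes x: "unimodular x" and y: "unimodular y"
    and le: "Re (fst x * snd x * cnj (fst y * snd y)) \<le> cmod (snd x) * cmod (snd y) * (cmod (snd x) * cmod (snd y) - 1)"
  shows "disjoint_disks x y"
proof -
  let ?C = "cmod (snd x)" and ?D = "cmod (snd y)"
  have sq: "(cmod (z - w))\<^sup>2 = (cmod z)\<^sup>2 + (cmod w)\<^sup>2 - 2 * Re (z * cnj w)" for z w
    unfolding cmod_power2 by (simp add: power2_eq_square algebra_simps)
  have A: "(cmod (fst x))\<^sup>2 = 1 + ?C\<^sup>2" "(cmod (fst y))\<^sup>2 = 1 + ?D\<^sup>2"
    using x y by (simp_all add: unimodular_def algebra_simps)
  have re: "fst x * cnj (snd y) * cnj (fst y * cnj (snd x)) = fst x * snd x * cnj (fst y * snd y)"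
    by simp
  have "(?C + ?D)\<^sup>2 \<le> (1 + ?C\<^sup>2) * ?D\<^sup>2 + (1 + ?D\<^sup>2) * ?C\<^sup>2
      - 2 * Re (fst x * snd x * cnj (fst y * snd y))"
    using le by (simp add: power2_eq_square algebra_simps)
  also have "\<dots> = (cmod (fst x * cnj (snd y) - fst y * cnj (snd x)))\<^sup>2"
    unfolding sq re by (simp add: norm_mult power_mult_distrib A)
  finally show ?thesis unfolding disjoint_disks_def by (rule power2_le_imp_le) simp
qed

lemma disjoint_disks_if_separated_directions:
  assumes "unimodular x" "unimodular y" "snd x \<noteq> 0" "snd y \<noteq> 0"
    and P: "fst x * snd x = of_real (cmod (fst x) * cmod (snd x)) * P"
    and Q: "fst y * snd y = of_real (cmod (fst y) * cmod (snd y)) * Q"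
    and le: "Re (P * cnj Q) \<le> (cmod (snd x) * cmod (snd y) - 1) / (cmod (fst x) * cmod (fst y))"
  shows "disjoint_disks x y"
proof (rule disjoint_disksI)
  let ?A = "cmod (fst x)" and ?B = "cmod (fst y)" and ?C = "cmod (snd x)" and ?D = "cmod (snd y)"
  have AB: "0 < ?A * ?B"
    using unimodular_ge_one[OF assms(1)] unimodular_ge_one[OF assms(2)] by (intro mult_pos_pos) auto
  have Re_scale: "Re (of_real r * w) = r * Re w" for r w by simp
  have "fst x * snd x * cnj (fst y * snd y) = of_real ((?A * ?C) * (?B * ?D)) * (P * cnj Q)"
    unfolding P Q by simp
  then have "Re (fst x * snd x * cnj (fst y * snd y)) = (?C * ?D) * (Re (P * cnj Q) * (?A * ?B))"
    by (simp only: Re_scale) (simp only: mult_ac)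
  also have "\<dots> \<le> (?C * ?D) * (?C * ?D - 1)"
    using le AB by (intro mult_left_mono) (simp_all add: pos_le_divide_eq)
  finally show "Re (fst x * snd x * cnj (fst y * snd y)) \<le> ?C * ?D * (?C * ?D - 1)" .
qed (use assms in auto)

definition direction_angle :: "complex \<times> complex \<Rightarrow> complex \<times> complex \<times> real" where
  "direction_angle x = (fst x / cmod (fst x), snd x / cmod (snd x), 2 * arcsin (1 / cmod (fst x)))"

lemma half_angle:
  assumes x: "unimodular x"
  shows "sin (arcsin (1 / cmod (fst x))) = 1 / cmod (fst x)"
    "cos (arcsin (1 / cmod (fst x))) = cmod (snd x) / cmod (fst x)"
proof -
  have A: "1 \<le> cmod (fst x)" by (rule unimodular_ge_one[OF x])
  then have r: "-1 \<le> 1 / cmod (fst x)" "1 / cmod (fst x) \<le> 1"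
    by (auto simp: divide_simps)
  then show "sin (arcsin (1 / cmod (fst x))) = 1 / cmod (fst x)" by simp
  have "cos (arcsin (1 / cmod (fst x))) = sqrt (1 - (1 / cmod (fst x))\<^sup>2)"
    by (rule cos_arcsin[OF r])
  also have "1 - (1 / cmod (fst x))\<^sup>2 = (cmod (snd x) / cmod (fst x))\<^sup>2"
  proof -
    have "(cmod (snd x))\<^sup>2 = (cmod (fst x))\<^sup>2 - 1" using x by (simp add: unimodular_def)
    then show ?thesis using A by (auto simp: power_divide diff_divide_distrib)
  qed
  finally show "cos (arcsin (1 / cmod (fst x))) = cmod (snd x) / cmod (fst x)" by simp
qed

text \<open>A disk cuts out an arc of half-length \<open>arcsin (1 / \<bar>a\<bar>)\<close>, so this is the cosine
  of the smallest angle at which two disks have disjoint interiors, as it appears in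
  \<open>disjoint_disks_if_separated_directions\<close>.\<close>

lemma cos_half_sum:
  assumes "unimodular x" "unimodular y"
  shows "cos (arcsin (1 / cmod (fst x)) + arcsin (1 / cmod (fst y)))
    = (cmod (snd x) * cmod (snd y) - 1) / (cmod (fst x) * cmod (fst y))"
  unfolding cos_add half_angle[OF assms(1)] half_angle[OF assms(2)] by (simp add: diff_divide_distrib)

lemma discrete_if_separated_pair:
  assumes x: "unimodular x" and y: "unimodular y"
    and sep: "separated_pair (direction_angle x) (direction_angle y)"
  shows "discrete_in_PSL2C (generate PSL2C {elem_of x, elem_of y})"
proof -
  define u v u' v' where uv: "u = fst x / cmod (fst x)" "v = snd x / cmod (snd x)"
    "u' = fst y / cmod (fst y)" "v' = snd y / cmod (snd y)"
  define s t where st: "s = arcsin (1 / cmod (fst x))" "t = arcsin (1 / cmod (fst y))"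
  have n: "cmod u = 1" "cmod v = 1" "cmod u' = 1" "cmod v' = 1"
    and sp: "separated (2 * s) (2 * t) (- 1 / u\<^sup>2) (u' * v' / (u * v)) (- v' / (u' * u * v))"
    using sep unfolding separated_pair_def direction_angle_def prod.case uv st by blast+
  have nz: "snd x \<noteq> 0" "snd y \<noteq> 0" using n(2,4) by (auto simp: uv)
  have fz: "fst x \<noteq> 0" "fst y \<noteq> 0" using n(1,3) by (auto simp: uv)
  have unit: "z * cnj z = 1" "inverse z = cnj z" if "cmod z = 1" for z
  proof -
    show "z * cnj z = 1" using that by (simp add: complex_norm_square[symmetric])
    then show "inverse z = cnj z" by (metis inverse_unique)
  qed
  note units = unit(1)[OF n(1)] unit(1)[OF n(2)] unit(1)[OF n(3)] unit(1)[OF n(4)]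
  \<comment> \<open>The directions of the centres of the four disks; on the unit circle the conjugate is the inverse.\<close>
  define p1 p2 q1 q2 where pq: "p1 = u * v" "p2 = - (cnj u * v)" "q1 = u' * v'" "q2 = - (cnj u' * v')"
  have X: "- 1 / u\<^sup>2 = p2 * cnj p1"
    using units unfolding pq by (simp add: divide_inverse unit(2) n power2_eq_square algebra_simps)
  have Y: "u' * v' / (u * v) = q1 * cnj p1"
    unfolding pq by (simp add: divide_inverse unit(2) n)
  have Z: "- v' / (u' * u * v) = q2 * cnj p1"
    unfolding pq by (simp add: divide_inverse unit(2) n)
  have p1: "p1 * cnj p1 = 1" "q1 * cnj q1 = 1"
    by (rule unit; simp add: pq norm_mult n)+
  have YX: "q1 * cnj p1 * cnj (p2 * cnj p1) = q1 * cnj p2" using p1 by (simp add: algebra_simps)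
  have ZX: "q2 * cnj p1 * cnj (p2 * cnj p1) = q2 * cnj p2" using p1 by (simp add: algebra_simps)
  have ZY: "q2 * cnj p1 * cnj (q1 * cnj p1) = q2 * cnj q1" using p1 by (simp add: algebra_simps)
  have c: "cos (2 * s) = (cmod (snd x) * cmod (snd x) - 1) / (cmod (fst x) * cmod (fst x))"
    "cos (2 * t) = (cmod (snd y) * cmod (snd y) - 1) / (cmod (fst y) * cmod (fst y))"
    "cos ((2 * s + 2 * t) / 2) = (cmod (snd y) * cmod (snd x) - 1) / (cmod (fst y) * cmod (fst x))"
    using cos_half_sum[OF x x] cos_half_sum[OF y y] cos_half_sum[OF x y]
    by (simp_all add: st mult.commute add_divide_distrib)
  note sep6 = sp[unfolded separated_def X Y Z YX ZX ZY c]
  let ?x = "entries_inv x" and ?y = "entries_inv y"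
  have e: "cmod (fst ?x) = cmod (fst x)" "cmod (snd ?x) = cmod (snd x)"
    "cmod (fst ?y) = cmod (fst y)" "cmod (snd ?y) = cmod (snd y)"
    by (simp_all add: entries_inv_def)
  have d: "fst x * snd x = of_real (cmod (fst x) * cmod (snd x)) * p1"
    "fst ?x * snd ?x = of_real (cmod (fst ?x) * cmod (snd ?x)) * p2"
    "fst y * snd y = of_real (cmod (fst y) * cmod (snd y)) * q1"
    "fst ?y * snd ?y = of_real (cmod (fst ?y) * cmod (snd ?y)) * q2"
    using nz fz by (simp_all add: e pq uv entries_inv_def)
  have ux: "unimodular ?x" and uy: "unimodular ?y" by (intro unimodular_inv x y)+
  have nzi: "snd ?x \<noteq> 0" "snd ?y \<noteq> 0" using nz by (simp_all add: entries_inv_def)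
  have disj: "disjoint_disks ?x x" "disjoint_disks y x" "disjoint_disks ?y x"
    "disjoint_disks y ?x" "disjoint_disks ?y ?x" "disjoint_disks ?y y"
    using sep6
    by (auto intro!: disjoint_disks_if_separated_directions[OF ux x nzi(1) nz(1) d(2,1)]
      disjoint_disks_if_separated_directions[OF y x nz(2) nz(1) d(3,1)]
      disjoint_disks_if_separated_directions[OF uy x nzi(2) nz(1) d(4,1)]
      disjoint_disks_if_separated_directions[OF y ux nz(2) nzi(1) d(3,2)]
      disjoint_disks_if_separated_directions[OF uy ux nzi(2) nzi(1) d(4,2)]
      disjoint_disks_if_separated_directions[OF uy y nzi(2) nz(2) d(4,3)] simp: e simp del: times_divide_eq_right)
  show ?thesis
  proof (rule discrete_if_disjoint_disks[OF x y nz])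
    fix l m :: "bool \<times> bool"
    assume "l \<noteq> m"
    then show "disjoint_disks (letter_val x y l) (letter_val x y m)"
      using disj disj[THEN disjoint_disks_sym[THEN iffD1]]
      by (cases l; cases m) (auto simp: letter_val_def)
  qed
qed

text \<open>The arcsine is continuous on \<open>[-1, 1]\<close> only; clamping its argument to this interval changes
  nothing for entries of determinant \<open>1\<close>.\<close>

lemma direction_angle_measurable_extension:
  "\<exists>T \<in> borel \<rightarrow>\<^sub>M borel. \<forall>x. unimodular x \<longrightarrow> T x = direction_angle x"
proof (intro bexI allI impI)
  let ?f = "\<lambda>r::real. arcsin (max (-1) (min 1 r))"
  let ?T = "\<lambda>x. (fst x / of_real (cmod (fst x)), snd x / of_real (cmod (snd x)), 2 * ?f (1 / cmod (fst x)))"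
  have [measurable]: "?f \<in> borel_measurable borel"
    by (intro borel_measurable_continuous_onI continuous_intros) auto
  show "?T \<in> borel \<rightarrow>\<^sub>M borel" unfolding borel_prod[symmetric] by measurable
  fix x assume "unimodular x"
  then have "1 / cmod (fst x) \<le> 1" using unimodular_ge_one[of x] by (auto simp: divide_simps)
  moreover have "-1 \<le> 1 / cmod (fst x)" by (rule order_trans[of _ 0]) auto
  ultimately show "?T x = direction_angle x" by (simp add: direction_angle_def min_absorb2 max_absorb2)
qed

theorem theorem7p3:
  fixes M :: "'w measure" and f g :: "'w \<Rightarrow> (complex^2^2) set"
  assumes "prob_space M"
    and "independent_random_elements M f g"
  shows "measure M {\<omega> \<in> space M. discrete_in_PSL2C (generate PSL2C {f \<omega>, g \<omega>})} \<ge> 1 / 20"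
proof -
  interpret prob_space M by (rule assms(1))
  obtain a c b d where ac: "random_entries M a c" and bd: "random_entries M b d"
    and ind: "indep_var borel (\<lambda>\<omega>. (a \<omega>, c \<omega>)) borel (\<lambda>\<omega>. (b \<omega>, d \<omega>))"
    and fg: "\<And>\<omega>. \<omega> \<in> space M \<Longrightarrow> f \<omega> = elem_of (a \<omega>, c \<omega>)" "\<And>\<omega>. \<omega> \<in> space M \<Longrightarrow> g \<omega> = elem_of (b \<omega>, d \<omega>)"
    using assms(2) unfolding independent_random_elements_def elem_of_def fst_conv snd_conv by blast
  obtain T where T [measurable]: "T \<in> borel \<rightarrow>\<^sub>M borel" and T_eq: "\<And>x. unimodular x \<Longrightarrow> T x = direction_angle x"
    using direction_angle_measurable_extension by metis
  have law: "distr M borel (\<lambda>\<omega>. T (a \<omega>, c \<omega>)) = element_law"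
    and uni: "\<And>\<omega>. \<omega> \<in> space M \<Longrightarrow> unimodular (a \<omega>, c \<omega>)"
    and meas: "a \<in> borel_measurable M" "c \<in> borel_measurable M"
    if "random_entries M a c" for a c
  proof -
    show uni: "unimodular (a \<omega>, c \<omega>)" if "\<omega> \<in> space M" for \<omega>
      using \<open>random_entries M a c\<close> that by (simp add: random_entries_def unimodular_def)
    show "a \<in> borel_measurable M" "c \<in> borel_measurable M"
      using that by (simp_all add: random_entries_def)
    have "distr M borel (\<lambda>\<omega>. T (a \<omega>, c \<omega>))
      = distr M borel (\<lambda>\<omega>. (a \<omega> / cmod (a \<omega>), c \<omega> / cmod (c \<omega>), 2 * arcsin (1 / cmod (a \<omega>))))"
      by (rule distr_cong) (simp_all add: T_eq uni direction_angle_def)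
    then show "distr M borel (\<lambda>\<omega>. T (a \<omega>, c \<omega>)) = element_law"
      using that by (simp add: random_entries_def)
  qed
  note [measurable] = meas[OF ac] meas[OF bd]
  define X Y where XY: "X = (\<lambda>\<omega>. T (a \<omega>, c \<omega>))" "Y = (\<lambda>\<omega>. T (b \<omega>, d \<omega>))"
  have "indep_var borel (T \<circ> (\<lambda>\<omega>. (a \<omega>, c \<omega>))) borel (T \<circ> (\<lambda>\<omega>. (b \<omega>, d \<omega>)))"
    by (rule indep_var_compose[OF ind T T])
  then have iXY: "indep_var borel X borel Y" by (simp add: XY comp_def)
  then have [measurable]: "random_variable borel X" "random_variable borel Y"
    by (simp_all add: indep_var_distribution_eq)
  have joint: "distr M (borel \<Otimes>\<^sub>M borel) (\<lambda>\<omega>. (X \<omega>, Y \<omega>)) = element_law \<Otimes>\<^sub>M element_law"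
    using iXY law[OF ac] law[OF bd] unfolding indep_var_distribution_eq XY by simp
  interpret E: prob_space element_law
    by (intro prob_space_pair prob_uniform_circle arc.prob_space_axioms)
  let ?S = "{\<omega> \<in> space M. separated_pair (X \<omega>) (Y \<omega>)}"
  let ?D = "{\<omega> \<in> space M. discrete_in_PSL2C (generate PSL2C {f \<omega>, g \<omega>})}"
  have sep: "(\<lambda>(p, q). if separated_pair p q then 1 else 0 :: ennreal) \<in> borel_measurable (element_law \<Otimes>\<^sub>M element_law)"
    using separated_pair_measurable unfolding case_prod_unfold by measurable
  then have sep': "(\<lambda>(p, q). if separated_pair p q then 1 else 0 :: ennreal) \<in> borel_measurable (borel \<Otimes>\<^sub>M borel)"
    unfolding joint[symmetric] by simp
  have pXY: "(\<lambda>\<omega>. (X \<omega>, Y \<omega>)) \<in> M \<rightarrow>\<^sub>M borel \<Otimes>\<^sub>M borel" by measurable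
  have ind: "(\<lambda>\<omega>. if separated_pair (X \<omega>) (Y \<omega>) then 1 else 0 :: ennreal) \<in> borel_measurable M"
    using measurable_compose[OF pXY sep'] by simp
  have S: "?S \<in> sets M"
  proof -
    have "?S = (\<lambda>\<omega>. if separated_pair (X \<omega>) (Y \<omega>) then 1 else 0 :: ennreal) -` {1} \<inter> space M"
      by (auto split: if_splits)
    then show ?thesis using measurable_sets[OF ind, of "{1}"] by simp
  qed
  have "ennreal (1 / 20) \<le> (\<integral>\<^sup>+p. (\<integral>\<^sup>+q. (if separated_pair p q then 1 else 0) \<partial>element_law) \<partial>element_law)"
    by (rule separated_pair_probability)
  also have "\<dots> = (\<integral>\<^sup>+(p, q). (if separated_pair p q then 1 else 0) \<partial>(element_law \<Otimes>\<^sub>M element_law))"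
    using E.nn_integral_fst[OF sep] by simp
  also have "\<dots> = (\<integral>\<^sup>+\<omega>. (if separated_pair (X \<omega>) (Y \<omega>) then 1 else 0) \<partial>M)"
    unfolding joint[symmetric] by (subst nn_integral_distr[OF pXY]) (use sep' in simp_all)
  also have "\<dots> = (\<integral>\<^sup>+\<omega>. indicator ?S \<omega> \<partial>M)"
    by (intro nn_integral_cong) (simp add: indicator_def)
  also have "\<dots> = emeasure M ?S" using S by (rule nn_integral_indicator)
  also have "\<dots> \<le> emeasure M ?D"
  proof (rule emeasure_mono)
    have "?D = {\<omega> \<in> space M. discrete_in_PSL2C (generate PSL2C {elem_of (a \<omega>, c \<omega>), elem_of (b \<omega>, d \<omega>)})}"
      using fg by auto
    also have "\<dots> \<in> sets M"
      using uni[OF ac] uni[OF bd] by (intro discrete_event_measurable) simp_all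
    finally show "?D \<in> sets M" .
    show "?S \<subseteq> ?D"
      using uni[OF ac] uni[OF bd] by (auto simp: fg XY T_eq intro!: discrete_if_separated_pair)
  qed
  finally have "ennreal (1 / 20) \<le> ennreal (measure M ?D)" by (simp only: emeasure_eq_measure)
  then show ?thesis by (simp only: ennreal_le_iff measure_nonneg)
qed

end
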